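(* Fix real numbers $0<\alpha<\beta<1$ such that $\beta<2\sqrt\alpha-\alpha$ (equivalently $(\alpha+\beta)^2<4\alpha$). Then there exist a real $\delta=\delta(\alpha,\beta)>0$ and a positive integer $n_0=n_0(\alpha,\beta)$ such that every degree sequence $D=(d_1,\ldots,d_n)$ of positive integers satisfying $\alpha<\frac{d_i}{n-1}<\beta$ for $i=1,\ldots,n$ is $\delta$-tame provided $n>n_0$. One can choose $$n_0=\max\Big\{\frac{\beta}{\alpha(1-\beta)},\ \frac{4(\beta-\alpha)}{4\alpha-(\alpha+\beta)^2}\Big\}+1\quad\text{and}\quad \delta=\frac{\epsilon^6}{1+\epsilon^6},\ \text{where } \epsilon=\min\Big\{\alpha,\ \alpha-\frac{(\alpha+\beta)^2}{4}\Big\}.$$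
   Context: For $D=(d_1,\ldots,d_n)$, coordinates of $\mathbb{R}^{\binom n2}$ are indexed by unordered pairs $\{j,k\}$, $1\le j\ne k\le n$. $\mathcal{P}(D)$ is the polytope of $x=(\xi_{\{j,k\}})$ with $\sum_{j:\,j\ne k}\xi_{\{j,k\}}=d_k$ ($k=1,\ldots,n$) and $0\le\xi_{\{j,k\}}\le1$. $H(x)=\sum_{\{j,k\}}\big(\xi_{\{j,k\}}\ln\frac1{\xi_{\{j,k\}}}+(1-\xi_{\{j,k\}})\ln\frac1{1-\xi_{\{j,k\}}}\big)$; if $\mathcal{P}(D)\ne\emptyset$ its unique maximizer $z=(\zeta_{\{j,k\}})$ on $\mathcal{P}(D)$ is the maximum entropy matrix. For $0<\delta\le1/2$, $D$ is $\delta$-tame if $\mathcal{P}(D)\ne\emptyset$ and $\delta\le\zeta_{\{j,k\}}\le1-\delta$ for all $j\ne k$. *)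

theory Defs
  imports "HOL-Analysis.Analysis"
begin

definition pairs :: "nat \<Rightarrow> nat set set" where
  "pairs n = {{j, k} | j k. j \<in> {1..n} \<and> k \<in> {1..n} \<and> j \<noteq> k}"

text \<open>
  A point of the coordinate space indexed by the unordered pairs is a function on
  \<open>pairs n\<close>. It is required to be extensional (equal to \<open>undefined\<close> outside \<open>pairs n\<close>),
  so that points of the polytope are determined by their coordinates and the
  maximizer of the entropy can be unique.
\<close>

definition degree_polytope :: "nat \<Rightarrow> (nat \<Rightarrow> nat) \<Rightarrow> (nat set \<Rightarrow> real) set" where
  "degree_polytope n d =
     {x \<in> pairs n \<rightarrow>\<^sub>E UNIV.
        (\<forall>k\<in>{1..n}. (\<Sum>j\<in>{1..n} - {k}. x {j, k}) = real (d k)) \<and>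
        (\<forall>e\<in>pairs n. 0 \<le> x e \<and> x e \<le> 1)}"

text \<open>
  At a coordinate equal to 0 or 1 the usual convention that 0 times \<open>ln (1/0)\<close> is 0 applies;
  it holds literally here since division is total.
\<close>

definition entropy :: "nat \<Rightarrow> (nat set \<Rightarrow> real) \<Rightarrow> real" where
  "entropy n x = (\<Sum>e\<in>pairs n. x e * ln (1 / x e) + (1 - x e) * ln (1 / (1 - x e)))"

text \<open>
  Meaningful when the polytope is nonempty: the entropy is continuous and strictly concave
  on the compact convex polytope, hence has a unique maximizer there.
\<close>

definition max_entropy_matrix :: "nat \<Rightarrow> (nat \<Rightarrow> nat) \<Rightarrow> nat set \<Rightarrow> real" where
  "max_entropy_matrix n d =
     (THE z. is_arg_max (entropy n) (\<lambda>x. x \<in> degree_polytope n d) z)"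

definition tame :: "real \<Rightarrow> nat \<Rightarrow> (nat \<Rightarrow> nat) \<Rightarrow> bool" where
  "tame \<delta> n d \<longleftrightarrow>
     0 < \<delta> \<and> \<delta> \<le> 1 / 2 \<and> degree_polytope n d \<noteq> {} \<and>
     (\<forall>j\<in>{1..n}. \<forall>k\<in>{1..n}. j \<noteq> k \<longrightarrow>
        \<delta> \<le> max_entropy_matrix n d {j, k} \<and> max_entropy_matrix n d {j, k} \<le> 1 - \<delta>)"

end

theory Submission
  imports Defs
begin

text \<open>
  A critical point \<open>l\<close> of the Lagrangian dual
  \<open>\<Sum>\<^bsub>{j,k}\<^esub> ln (1 + exp (l j + l k)) - \<Sum>\<^bsub>k\<^esub> d k * l k\<close> yields a matrix
  \<open>\<zeta>\<^bsub>{j,k}\<^esub> = x j * x k / (1 + x j * x k)\<close>, \<open>x = exp l\<close>, with row sums \<open>d\<close>, and by Gibbs'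
  inequality this matrix is the unique entropy maximizer. Everything therefore rests on an a priori
  bound for the odds \<open>x j * x k\<close>. It only needs that the rows with \<open>x j > 1\<close> have sum at most
  the largest degree and those with \<open>x j < 1\<close> have sum at least the smallest degree, which also holds
  for a minimizer of the dual over a large box; so the bound simultaneously shows that
  this minimizer is interior, hence critical.

  For the a priori bound let \<open>a\<close> be the smallest degree, \<open>n - 1 - c\<close> the largest, and let \<open>S\<close>, \<open>T\<close>, \<open>U\<close>
  be the vertices with large, small and intermediate \<open>x\<close>. Subtracting the row sums over \<open>T\<close> from
  those over \<open>S\<close> bounds the number of missing edges inside \<open>S\<close> and between \<open>S\<close> and \<open>U\<close>, plus the
  number of edges inside \<open>T\<close> and between \<open>T\<close> and \<open>U\<close>, from below
  by \<open>a * c - (card S - a) * (card T - c)\<close>. If some odds exceed \<open>\<epsilon>\<^bsup>-6\<^esup>\<close>, then the rows of the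
  extreme vertices show that at least \<open>a\<close> vertices of \<open>S\<close> and \<open>c\<close> vertices of \<open>T\<close> are so extreme
  that they contribute almost nothing, while every other pair between \<open>S \<union> T\<close> and \<open>U\<close>
  contributes at most 1/2; this is too little. Lower bounds on the odds follow by passing to the
  complementary graph, \<open>x \<mapsto> 1 / x\<close>.
\<close>

section \<open>A numerical inequality for the extreme degrees\<close>


text \<open>The difference of the two sides is written as a combination with nonnegative
  coefficients for \<open>t \<ge> 0\<close>. The double roots 2/5 and 1/2 of its squares sit close
  to the minimum of the difference, which is positive but small.\<close>

lemma quintic_pos:
  fixes t :: real
  assumes "0 \<le> t"
  shows "6 * (1 + t\<^sup>2) + 2 * t * (10 + 9 * t) \<le> (1 + t\<^sup>2)\<^sup>2 * (10 + 9 * t)"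
proof -
  have "(1 + t\<^sup>2)\<^sup>2 * (10 + 9 * t) - (6 * (1 + t\<^sup>2) + 2 * t * (10 + 9 * t))
    = (t - 2 / 5)\<^sup>2 * (9 * t ^ 3 + 86 / 5 * t\<^sup>2 + 758 / 25 * t) + (4 * t - 2)\<^sup>2
      + 188 / 125 * t\<^sup>2 + 93 / 625 * t"
    by (simp add: field_simps power2_eq_square numeral_eq_Suc)
  moreover have "0 \<le> \<dots>" using assms by simp
  ultimately show ?thesis by simp
qed

text \<open>Both summands are homogeneous of degree 0 in \<open>r\<close> and \<open>h\<close>, so
  only the ratio \<open>t = h / r\<close> matters and the claim becomes
  \<open>quintic_pos\<close>.\<close>

lemma two_variable_bound:
  fixes r h :: real
  assumes "0 < r" "0 \<le> h"
  shows "6 * r ^ 3 / ((r\<^sup>2 + h\<^sup>2) * (10 * r + 9 * h)) + 2 * h * r ^ 3 / (r\<^sup>2 + h\<^sup>2)\<^sup>2 \<le> 1"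
proof -
  define t where "t = h / r"
  have h: "h = t * r" using assms by (simp add: t_def)
  have t: "0 \<le> t" using assms by (simp add: t_def)
  have p: "0 < 1 + t\<^sup>2" "0 < 10 + 9 * t"
    using t by (auto intro: add_pos_nonneg)
  have e: "r\<^sup>2 + h\<^sup>2 = r\<^sup>2 * (1 + t\<^sup>2)" "10 * r + 9 * h = r * (10 + 9 * t)"
    by (simp_all add: h algebra_simps power2_eq_square)
  have "6 * r ^ 3 / ((r\<^sup>2 + h\<^sup>2) * (10 * r + 9 * h)) = 6 / ((1 + t\<^sup>2) * (10 + 9 * t))"
    unfolding e using assms p by (simp add: divide_simps power2_eq_square numeral_eq_Suc)
  moreover have "2 * h * r ^ 3 / (r\<^sup>2 + h\<^sup>2)\<^sup>2 = 2 * t / (1 + t\<^sup>2)\<^sup>2"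
    unfolding e using assms p by (simp add: h power_mult_distrib divide_simps power2_eq_square numeral_eq_Suc)
  moreover have "6 / ((1 + t\<^sup>2) * (10 + 9 * t)) + 2 * t / (1 + t\<^sup>2)\<^sup>2
      = (6 * (1 + t\<^sup>2) + 2 * t * (10 + 9 * t)) / ((1 + t\<^sup>2)\<^sup>2 * (10 + 9 * t))"
    using p by (simp add: divide_simps power2_eq_square)
  moreover have "\<dots> \<le> 1"
    using quintic_pos[OF t] p by (simp add: divide_le_eq_1)
  ultimately show ?thesis by simp
qed

text \<open>
  With \<open>h = D / 2\<close> the quantity \<open>r\<^sup>2\<close> below equals \<open>s\<^sup>2 - h\<^sup>2 + 2 * h + 3/8\<close> for \<open>s = sqrt (a * c)\<close>;
  it is chosen so that \<open>e\<^sup>2 \<le> r\<^sup>2 * R\<close> in the notation of \<open>degree_margin_bound\<close>,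
  which removes the square root of \<open>R\<close> from the inequality there.
\<close>

lemma degree_margin_bound_aux:
  fixes a c D :: real
  assumes a: "1 \<le> a" and c: "1 \<le> c" and D: "D = 0 \<or> 1 \<le> D"
    and E: "D + 3 / 4 \<le> a * c - D\<^sup>2 / 4"
  defines "r \<equiv> sqrt (a * c - D\<^sup>2 / 4 + D + 3 / 8)"
  shows "(a + D) * (c + D + 1) * r ^ 3 \<le> c * (a * c + a + D) * (a + c + D)\<^sup>2"
proof -
  define s where "s = sqrt (a * c)"
  define h where "h = D / 2"
  define m where "m = a + c + D"
  define N where "N = a * c + a + D"
  have D0: "0 \<le> D" and h0: "0 \<le> h" using D by (auto simp: h_def)
  have ac1: "1 \<le> a * c" using mult_mono[OF a c] a c by simp
  have s2: "s\<^sup>2 = a * c" unfolding s_def using ac1 by simp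
  have s1: "1 \<le> s" unfolding s_def using ac1 by simp
  have r2: "r\<^sup>2 = s\<^sup>2 - h\<^sup>2 + 2 * h + 3 / 8"
    unfolding r_def s2 h_def using E D0 by (simp add: power2_eq_square)
  have r0: "0 < r" unfolding r_def using E D0 by simp
  have Es: "h\<^sup>2 + 2 * h + 3 / 4 \<le> s\<^sup>2" using E unfolding s2 by (simp add: h_def power2_eq_square)
  have amgm: "2 * s \<le> a + c"
  proof -
    have "sqrt (a * c) \<le> (a + c) / 2" using a c by (intro arith_geo_mean_sqrt) auto
    then show ?thesis by (simp add: s_def)
  qed
  have m0: "0 < m" using a c D0 by (simp add: m_def)
  have N0: "0 < N" using a ac1 D0 by (simp add: N_def)
  \<comment> \<open>Since \<open>(a + D) * (c + D + 1) = N + D * m\<close>, dividing the goal by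
    \<open>c * N * m^2\<close> leaves
    \<open>r^3 / (c * m^2) + D * r^3 / (c * N * m) \<le> 1\<close>. The bounds \<open>cm\<close>,
    \<open>m2\<close> and \<open>cNm\<close> replace these denominators by smaller ones in
    \<open>s\<close> and \<open>D\<close> alone; what remains is \<open>le1\<close>.\<close>
  have cm: "s\<^sup>2 + 1 + D \<le> c * m"
  proof -
    have "1 \<le> c * c" "D \<le> c * D" using mult_mono[OF c c] c mult_right_mono[OF c D0] by auto
    then show ?thesis by (simp add: m_def s2 algebra_simps)
  qed
  have m2: "2 * s + D \<le> m" using amgm by (simp add: m_def)
  have cNm: "(s\<^sup>2 + s + D)\<^sup>2 \<le> c * N * m"
  proof -
    have 1: "c \<le> c * c" "D \<le> c * D" using mult_right_mono[OF c] c D0 by fastforce+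
    have "a + c + 2 * D \<le> a + D + c * c + c * D" using 1 by simp
    then have "2 * (s + D) \<le> a + D + c * c + c * D" using amgm by simp
    then have 2: "s\<^sup>2 * (2 * (s + D)) \<le> (a * c) * (a + D + c * c + c * D)"
      unfolding s2 using ac1 by (intro mult_left_mono) auto
    have "(s + D)\<^sup>2 = a * c + D * (2 * s) + D * D"
      using s2 by (simp add: power2_eq_square algebra_simps)
    also have "\<dots> \<le> a * c + D * (a + c) + D * D"
      using mult_left_mono[OF amgm D0] by simp
    also have "\<dots> = 1 * ((a + D) * (c + D))" by (simp add: algebra_simps)
    also have "\<dots> \<le> c * ((a + D) * (c + D))"
      using a c D0 by (intro mult_right_mono mult_nonneg_nonneg) auto
    finally have 3: "(s + D)\<^sup>2 \<le> c * ((a + D) * (c + D))" .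
    have "(s\<^sup>2 + s + D)\<^sup>2 = (a*c)\<^sup>2 + s\<^sup>2 * (2 * (s + D)) + (s + D)\<^sup>2"
      unfolding s2[symmetric] by (simp add: power2_eq_square algebra_simps)
    also have "\<dots> \<le> (a*c)\<^sup>2 + (a * c) * (a + D + c * c + c * D) + c * ((a + D) * (c + D))"
      using 2 3 by simp
    also have "\<dots> = c * N * m" by (simp add: N_def m_def power2_eq_square algebra_simps)
    finally show ?thesis .
  qed
  have "0 < s\<^sup>2 + s + D" using s1 D0 by (intro add_pos_nonneg add_nonneg_pos) auto
  moreover have "0 < s\<^sup>2 + 1 + D" using D0 by (intro add_pos_nonneg add_nonneg_pos) auto
  ultimately have p: "0 < (s\<^sup>2 + 1 + D) * (2 * s + D)" "0 < (s\<^sup>2 + s + D)\<^sup>2"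
    using s1 D0 by simp_all
  have le1: "r ^ 3 / ((s\<^sup>2 + 1 + D) * (2 * s + D)) + D * r ^ 3 / (s\<^sup>2 + s + D)\<^sup>2 \<le> 1"
  proof (cases "D = 0")
    case True
    then have r2': "r\<^sup>2 = s\<^sup>2 + 3 / 8" using r2 by (simp add: h_def)
    have ss: "1 \<le> s\<^sup>2" using s1 by simp
    have "r\<^sup>2 \<le> (2 * s)\<^sup>2" using r2' ss by (simp add: power2_eq_square)
    then have "r \<le> 2 * s" by (rule power2_le_imp_le) (use s1 in simp)
    then have "r\<^sup>2 * r \<le> (s\<^sup>2 + 1) * (2 * s)" using r2' r0 s1 by (intro mult_mono) auto
    then have "r ^ 3 \<le> (s\<^sup>2 + 1) * (2 * s)" by (simp add: numeral_eq_Suc)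
    moreover have "0 < (s\<^sup>2 + 1) * (2 * s)" using s1 by (intro mult_pos_pos) (auto intro: add_nonneg_pos)
    ultimately show ?thesis using True by simp
  next
    case False
    then have h1: "1 / 2 \<le> h" using D by (simp add: h_def)
    have sh: "h + 3 / 4 \<le> s"
    proof -
      have "(h + 3 / 4)\<^sup>2 \<le> s\<^sup>2" using Es h1 by (simp add: power2_eq_square algebra_simps)
      then show ?thesis using s1 by (simp add: power2_le_iff_abs_le)
    qed
    have rr: "25 / 8 \<le> r\<^sup>2" using Es r2 h1 by simp
    \<comment> \<open>This is \<open>lin\<close> squared, because
      \<open>12 * (s + h) = 6 * (2 * s + D)\<close>. The square of \<open>5 * r - 18 * h\<close>
      absorbs the cross term \<open>180 * (r * h)\<close>.\<close>
    have "(10 * r + 9 * h)\<^sup>2 \<le> (12 * (s + h))\<^sup>2"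
    proof -
      have "h * (h + 3 / 4) \<le> h * s" using sh h0 by (intro mult_left_mono) auto
      moreover have "h * (1 / 2) \<le> h * h" using h1 h0 by (intro mult_left_mono) auto
      ultimately have "7 / 8 * r\<^sup>2 + 3 * h\<^sup>2 \<le> (s + h)\<^sup>2"
        using rr r2 by (simp add: power2_eq_square algebra_simps)
      then have 1: "126 * r\<^sup>2 + 432 * h\<^sup>2 \<le> 144 * (s + h)\<^sup>2" by simp
      have "0 \<le> (5 * r - 18 * h)\<^sup>2" by simp
      also have "(5 * r - 18 * h)\<^sup>2 = 25 * r\<^sup>2 - 180 * (r * h) + 324 * h\<^sup>2"
        by (simp add: power2_eq_square algebra_simps)
      finally have 2: "180 * (r * h) \<le> 25 * r\<^sup>2 + 324 * h\<^sup>2" by simp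
      have "(10 * r + 9 * h)\<^sup>2 = 100 * r\<^sup>2 + 180 * (r * h) + 81 * h\<^sup>2"
        by (simp add: power2_eq_square algebra_simps)
      also have "\<dots> \<le> 144 * (s + h)\<^sup>2"
        using 1 2 zero_le_power2[of r] zero_le_power2[of h] by linarith
      also have "144 * (s + h)\<^sup>2 = (12 * (s + h))\<^sup>2" unfolding power_mult_distrib by simp
      finally show ?thesis .
    qed
    then have lin: "(10 * r + 9 * h) / 6 \<le> 2 * s + D"
      using r0 h0 s1 by (simp add: power2_le_iff_abs_le h_def)
    have Y0: "0 < r\<^sup>2 + h\<^sup>2" using r0 by (intro add_pos_nonneg) auto
    have l0: "0 < (10 * r + 9 * h) / 6" using r0 h0 by simp
    have "(r\<^sup>2 + h\<^sup>2) * ((10 * r + 9 * h) / 6) \<le> (s\<^sup>2 + 1 + D) * (2 * s + D)"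
      using lin Y0 l0 r2 D0 by (intro mult_mono) (auto simp: h_def)
    then have 1: "r ^ 3 / ((s\<^sup>2 + 1 + D) * (2 * s + D)) \<le> r ^ 3 / ((r\<^sup>2 + h\<^sup>2) * ((10 * r + 9 * h) / 6))"
      using Y0 l0 r0 p(1) by (intro divide_left_mono mult_pos_pos[OF p(1)] mult_pos_pos[OF Y0 l0]) auto
    have "(r\<^sup>2 + h\<^sup>2)\<^sup>2 \<le> (s\<^sup>2 + s + D)\<^sup>2"
      using Y0 r2 s1 by (intro power_mono) (auto simp: h_def)
    then have 2: "D * r ^ 3 / (s\<^sup>2 + s + D)\<^sup>2 \<le> D * r ^ 3 / (r\<^sup>2 + h\<^sup>2)\<^sup>2"
      using Y0 r0 D0 p(2) by (intro divide_left_mono mult_pos_pos) auto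
    have 3: "r ^ 3 / ((r\<^sup>2 + h\<^sup>2) * ((10 * r + 9 * h) / 6)) = 6 * r ^ 3 / ((r\<^sup>2 + h\<^sup>2) * (10 * r + 9 * h))"
      by simp
    have "2 * h = D" by (simp add: h_def)
    then show ?thesis using 1[unfolded 3] 2 two_variable_bound[OF r0 h0] by simp
  qed
  have w1: "N * r ^ 3 \<le> (c * N * m\<^sup>2) * (r ^ 3 / ((s\<^sup>2 + 1 + D) * (2 * s + D)))"
  proof -
    have "(s\<^sup>2 + 1 + D) * (2 * s + D) \<le> (c * m) * m"
      using cm m2 s1 D0 c m0 by (intro mult_mono) auto
    then have "(N * r ^ 3) * ((s\<^sup>2 + 1 + D) * (2 * s + D)) \<le> (N * r ^ 3) * ((c * m) * m)"
      using N0 r0 by (intro mult_left_mono) auto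
    then show ?thesis using p(1) by (simp add: pos_le_divide_eq power2_eq_square mult_ac)
  qed
  have w2: "D * m * r ^ 3 \<le> (c * N * m\<^sup>2) * (D * r ^ 3 / (s\<^sup>2 + s + D)\<^sup>2)"
  proof -
    have "(D * m * r ^ 3) * (s\<^sup>2 + s + D)\<^sup>2 \<le> (D * m * r ^ 3) * (c * N * m)"
      using cNm D0 m0 r0 by (intro mult_left_mono) auto
    then show ?thesis using p(2) by (simp add: pos_le_divide_eq power2_eq_square mult_ac)
  qed
  have "(a + D) * (c + D + 1) * r ^ 3 = N * r ^ 3 + D * m * r ^ 3"
    by (simp add: N_def m_def algebra_simps)
  also have "\<dots> \<le> (c * N * m\<^sup>2) * (r ^ 3 / ((s\<^sup>2 + 1 + D) * (2 * s + D)) + D * r ^ 3 / (s\<^sup>2 + s + D)\<^sup>2)"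
    using w1 w2 by (simp add: distrib_left)
  also have "\<dots> \<le> c * N * m\<^sup>2"
    using le1 c N0 by (intro mult_left_le) auto
  finally show ?thesis by (simp add: N_def m_def)
qed

text \<open>Divided by suitable powers of \<open>a + c + D\<close>, the two inequalities become
  \<open>S_margin\<close> and \<open>T_margin\<close> in \<open>edge_odds_upper_bound\<close>: they
  say how far the extreme vertices are pushed out by odds beyond the claimed bound.\<close>

lemma degree_margin_bound:
  fixes a c D :: real
  assumes a: "1 \<le> a" and c: "1 \<le> c" and D: "D = 0 \<or> 1 \<le> D"
    and E: "D + 3 / 4 \<le> a * c - D\<^sup>2 / 4"
  defines "R \<equiv> a * c - (D + 1)\<^sup>2 / 4" and "e \<equiv> a * c - D\<^sup>2 / 4"
  shows "(a + D) * (c + D + 1) * e ^ 3 \<le> c * (a * c + a + D) * (a + c + D)\<^sup>2 * sqrt R ^ 3"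
    and "(a + D + 1) * e ^ 3 \<le> (a * c + c + D) * (a + c + D)\<^sup>2 * sqrt R ^ 3"
proof -
  define r where "r = sqrt (a * c - D\<^sup>2 / 4 + D + 3 / 8)"
  have D0: "0 \<le> D" using D by auto
  have R: "R = e - D / 2 - 1 / 4" unfolding R_def e_def by (simp add: power2_eq_square field_simps)
  have Rp: "0 < R" using E D0 unfolding R e_def by simp
  have r2: "r\<^sup>2 = e + D + 3 / 8" unfolding r_def e_def using E D0 by simp
  have r0: "0 \<le> r" unfolding r_def using E D0 by simp
  have e0: "0 \<le> e" using E D0 by (simp add: e_def)
  \<comment> \<open>The constant 3/8 in \<open>r^2\<close> is tuned to this step: at
    \<open>D = 0\<close> and \<open>e = 3/4\<close> the resulting \<open>e^2 \<le> r^2 * R\<close>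
    is an equality.\<close>
  have "(D + 3 / 4) * (D / 2 + 1 / 8) \<le> e * (D / 2 + 1 / 8)"
    using E D0 by (intro mult_right_mono) (auto simp: e_def)
  then have "e\<^sup>2 \<le> r\<^sup>2 * R" unfolding r2 R using D0
    by (simp add: power2_eq_square algebra_simps)
  then have "e\<^sup>2 \<le> (r * sqrt R)\<^sup>2" using Rp by (simp add: power_mult_distrib)
  then have "e \<le> r * sqrt R" using r0 Rp by (simp add: power2_le_iff_abs_le)
  then have "e ^ 3 \<le> (r * sqrt R) ^ 3" using e0 by (intro power_mono) auto
  then have e3: "e ^ 3 \<le> r ^ 3 * sqrt R ^ 3" by (simp add: power_mult_distrib)
  note main = degree_margin_bound_aux[OF a c D E, folded r_def]
  have "(a + D) * (c + D + 1) * e ^ 3 \<le> (a + D) * (c + D + 1) * (r ^ 3 * sqrt R ^ 3)"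
    using e3 a c D0 by (intro mult_left_mono) auto
  also have "\<dots> \<le> c * (a * c + a + D) * (a + c + D)\<^sup>2 * sqrt R ^ 3"
    using mult_right_mono[OF main, of "sqrt R ^ 3"] Rp by (simp add: mult_ac)
  finally show 1: "(a + D) * (c + D + 1) * e ^ 3 \<le> c * (a * c + a + D) * (a + c + D)\<^sup>2 * sqrt R ^ 3" .
  define k where "k = c * (a * c + a + D)"
  define l where "l = (a + D) * (c + D + 1)"
  have l0: "0 < l" using a c D0 by (auto simp: l_def intro!: mult_pos_pos)
  \<comment> \<open>Through this comparison of ratios the second inequality follows from the
    first.\<close>
  have kl: "(a + D + 1) * k \<le> (a * c + c + D) * l"
  proof -
    have "(a * c + c + D) * l - (a + D + 1) * k
      = D * ((a + D) + (a + D) * (a * c + c + D) + c * c)"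
      by (simp add: k_def l_def algebra_simps)
    moreover have "0 \<le> \<dots>" using a c D0 by (intro mult_nonneg_nonneg add_nonneg_nonneg) auto
    ultimately show ?thesis by simp
  qed
  have "((a + D + 1) * e ^ 3) * l = (a + D + 1) * (l * e ^ 3)" by simp
  also have "\<dots> \<le> (a + D + 1) * (k * ((a + c + D)\<^sup>2 * sqrt R ^ 3))"
    using 1 a D0 by (intro mult_left_mono) (auto simp: k_def l_def mult_ac)
  also have "\<dots> = ((a + D + 1) * k) * ((a + c + D)\<^sup>2 * sqrt R ^ 3)" by simp
  also have "\<dots> \<le> ((a * c + c + D) * l) * ((a + c + D)\<^sup>2 * sqrt R ^ 3)"
    using kl Rp by (intro mult_right_mono) auto
  finally have "((a + D + 1) * e ^ 3) * l \<le> ((a * c + c + D) * (a + c + D)\<^sup>2 * sqrt R ^ 3) * l"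
    by (simp add: mult_ac)
  then show "(a + D + 1) * e ^ 3 \<le> (a * c + c + D) * (a + c + D)\<^sup>2 * sqrt R ^ 3"
    using l0 by simp
qed


section \<open>The a priori bound on the odds\<close>

text \<open>The probability belonging to the odds \<open>t\<close>; at \<open>exp s\<close> it is
  the logistic function of \<open>s\<close>.\<close>

definition edge_prob :: "real \<Rightarrow> real" where
  "edge_prob t = t / (1 + t)"

lemma edge_prob_le: "0 \<le> t \<Longrightarrow> edge_prob t \<le> t"
  by (simp add: edge_prob_def divide_le_eq algebra_simps)

lemma edge_prob_mono: "0 \<le> s \<Longrightarrow> s \<le> t \<Longrightarrow> edge_prob s \<le> edge_prob t"
  by (simp add: edge_prob_def frac_le_eq divide_simps algebra_simps)

lemma one_minus_edge_prob: "0 < t \<Longrightarrow> 1 - edge_prob t = edge_prob (1 / t)"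
  by (simp add: edge_prob_def divide_simps)

lemma edge_prob_le_half: "0 \<le> t \<Longrightarrow> t \<le> 1 \<Longrightarrow> edge_prob t \<le> 1 / 2"
  by (simp add: edge_prob_def divide_le_eq)

lemma one_minus_edge_prob_le:
  assumes "0 < k" "1 / k \<le> t"
  shows "1 - edge_prob t \<le> k"
proof -
  have t: "0 < t" using assms by (meson divide_pos_pos less_le_trans zero_less_one)
  then have "1 - edge_prob t \<le> 1 / t" by (simp add: one_minus_edge_prob edge_prob_le)
  also have "1 / t \<le> k" using assms t by (simp add: field_simps)
  finally show ?thesis .
qed

lemma one_minus_edge_prob_le_half: "1 \<le> t \<Longrightarrow> 1 - edge_prob t \<le> 1 / 2"
  using edge_prob_le_half[of "1 / t"] by (simp add: one_minus_edge_prob)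

text \<open>Bounds the error in one row, with \<open>A\<close> the own class of the vertex
  \<open>i\<close> and \<open>B\<close> the intermediate class. The part with \<kappa> is the same
  for near and far rows, so that only the multiples of 1/2 depend on the row when rows are added
  up.\<close>

lemma sum_near_far_le:
  fixes f :: "'a \<Rightarrow> real" and \<kappa> :: real
  assumes "finite A" "finite B" "A \<inter> B = {}" "i \<in> A" "0 \<le> \<kappa>"
    and A: "\<And>j. j \<in> A \<Longrightarrow> f j \<le> \<kappa>"
    and B: "\<And>j. j \<in> B \<Longrightarrow> f j \<le> (if far then \<kappa> else 1 / 2)"
  shows "(\<Sum>j\<in>A \<union> B - {i}. f j) \<le> \<kappa> * (real (card A) + card B - 1) + (if far then 0 else card B / 2)"
proof -
  have "A \<union> B - {i} = (A - {i}) \<union> B" using assms by auto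
  then have "(\<Sum>j\<in>A \<union> B - {i}. f j) = (\<Sum>j\<in>A - {i}. f j) + (\<Sum>j\<in>B. f j)"
    using assms by (simp add: sum.union_disjoint disjoint_iff)
  also have "\<dots> \<le> (\<Sum>j\<in>A - {i}. \<kappa>) + (\<Sum>j\<in>B. if far then \<kappa> else 1 / 2)"
    using A B by (intro add_mono sum_mono) auto
  also have "\<dots> = \<kappa> * (real (card A) - 1) + (if far then card B * \<kappa> else card B / 2)"
    using assms card_gt_0_iff[of A] by (auto simp: of_nat_diff)
  also have "\<dots> \<le> \<kappa> * (real (card A) + card B - 1) + (if far then 0 else card B / 2)"
    using assms by (simp add: algebra_simps)
  finally show ?thesis .
qed

text \<open>
  The threshold is the value for which \<open>a - 1\<close> terms equal to the upper bound and the rest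
  equal to the threshold sum up to exactly \<open>a\<close>.
\<close>

lemma many_large_terms:
  fixes f :: "'a \<Rightarrow> real" and a D c :: nat
  assumes fin: "finite W" and card: "card W = a + c + D"
    and sum: "real a \<le> (\<Sum>k\<in>W. f k)"
    and ub: "\<And>k. k \<in> W \<Longrightarrow> f k \<le> (a + D) / (a + c + D)"
    and a: "1 \<le> a"
  shows "a \<le> card {k \<in> W. (a * c + a + D) / ((a + c + D) * (c + D + 1)) \<le> f k}"
proof (rule ccontr)
  define \<eta> :: real where "\<eta> = (a * c + a + D) / ((a + c + D) * (c + D + 1))"
  define \<beta> :: real where "\<beta> = (a + D) / (a + c + D)"
  define L where "L = {k \<in> W. \<eta> \<le> f k}"
  assume "\<not> ?thesis"
  then have lt: "card L < a" by (simp add: L_def \<eta>_def)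
  have LW: "L \<subseteq> W" "finite L" using fin by (auto simp: L_def)
  have cWL: "card (W - L) = a + c + D - card L" using LW card by (simp add: card_Diff_subset)
  have m0: "0 < real (a + c + D)" using a by simp
  have "\<eta> \<le> \<beta>"
  proof -
    have "real (a * c + a + D) \<le> real ((a + D) * (c + D + 1))"
      by (subst of_nat_le_iff) (simp add: algebra_simps)
    then have "\<eta> \<le> real ((a + D) * (c + D + 1)) / real ((a + c + D) * (c + D + 1))"
      unfolding \<eta>_def by (intro divide_right_mono) auto
    also have "\<dots> = \<beta>" unfolding \<beta>_def of_nat_mult by (rule mult_divide_mult_cancel_right) simp
    finally show ?thesis .
  qed
  have "W - L \<noteq> {}" using cWL lt by force
  then have "(\<Sum>k\<in>W - L. f k) < (\<Sum>k\<in>W - L. \<eta>)"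
    using fin by (intro sum_strict_mono) (auto simp: L_def)
  moreover have "(\<Sum>k\<in>L. f k) \<le> (\<Sum>k\<in>L. \<beta>)"
    using LW ub by (intro sum_mono) (auto simp: \<beta>_def)
  moreover have "(\<Sum>k\<in>W. f k) = (\<Sum>k\<in>W - L. f k) + (\<Sum>k\<in>L. f k)"
    using LW fin by (intro sum.subset_diff) auto
  ultimately have "real a < card (W - L) * \<eta> + card L * \<beta>" using sum by simp
  also have "\<dots> = (real (a + c + D) - card L) * \<eta> + card L * \<beta>"
    using cWL lt by (simp add: of_nat_diff)
  also have "\<dots> = real (a + c + D) * \<eta> + card L * (\<beta> - \<eta>)"
    by (simp add: algebra_simps)
  also have "\<dots> \<le> real (a + c + D) * \<eta> + (real a - 1) * (\<beta> - \<eta>)"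
    using \<open>\<eta> \<le> \<beta>\<close> lt by (intro add_left_mono mult_right_mono) auto
  also have "\<dots> = real (c + D + 1) * \<eta> + (real a - 1) * \<beta>"
    by (simp add: algebra_simps)
  also have "real (c + D + 1) * \<eta> = real (a * c + a + D) / real (a + c + D)"
    unfolding \<eta>_def of_nat_mult[of "a + c + D"] by (simp del: of_nat_add of_nat_mult)
  also have "real (a * c + a + D) / real (a + c + D) + (real a - 1) * \<beta> = a"
  proof -
    have "real (a * c + a + D) + (real a - 1) * real (a + D) = real a * real (a + c + D)"
      by (simp add: algebra_simps)
    then show ?thesis using m0 by (simp add: \<beta>_def add_divide_distrib[symmetric] divide_eq_eq)
  qed
  finally show False by simp
qed


text \<open>The exponent 6 is 2 times 3. Far vertices have to lie beyond \<open>q^3\<close> or its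
  reciprocal, so that paired with an intermediate vertex, which costs at most a factor
  \<open>q\<close>, they still have odds beyond \<open>q^2 = \<kappa>\<close> or its reciprocal. The
  factor 2 comes from bounding a product of two entries by the square of the largest one.\<close>

lemma edge_odds_upper_bound:
  fixes V :: "'a set" and x :: "'a \<Rightarrow> real" and a c D :: nat
  assumes fin: "finite V" and card: "card V = a + c + D + 1"
    and a: "1 \<le> a" and c: "1 \<le> c"
    and pos: "\<And>i. i \<in> V \<Longrightarrow> 0 < x i"
    and upper: "\<And>i. i \<in> V \<Longrightarrow> 1 < x i \<Longrightarrow> (\<Sum>j\<in>V - {i}. edge_prob (x i * x j)) \<le> a + D"
    and lower: "\<And>i. i \<in> V \<Longrightarrow> x i < 1 \<Longrightarrow> a \<le> (\<Sum>j\<in>V - {i}. edge_prob (x i * x j))"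
    and E: "real D + 3 / 4 \<le> real a * real c - (real D)\<^sup>2 / 4"
    and ij: "i \<in> V" "j \<in> V" "i \<noteq> j"
  defines "e \<equiv> (real a * real c - (real D)\<^sup>2 / 4) / (real a + real c + real D)\<^sup>2"
  shows "x i * x j * e ^ 6 \<le> 1"
proof (rule ccontr)
  assume "\<not> ?thesis"
  then have big: "1 < x i * x j * e ^ 6" by simp
  define m where "m = real a + real c + real D"
  \<comment> \<open>\<open>R\<close> is a lower bound for the weighted count in step
    \<open>2\<close> below, whatever the class sizes are. The errors of size \<kappa> are counted
    fewer than \<open>m^2\<close> times, so \<open>\<kappa> = R / m^2\<close> makes their total less
    than \<open>R\<close>.\<close>
  define R where "R = real a * real c - (real D + 1)\<^sup>2 / 4"
  define \<kappa> where "\<kappa> = R / m\<^sup>2"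
  define q where "q = sqrt \<kappa>"
  \<comment> \<open>The thresholds of \<open>many_large_terms\<close> for the row of the smallest
    entry and, with \<open>a\<close> and \<open>c\<close> exchanged, for the complements in the row
    of the largest entry.\<close>
  define \<eta>S where "\<eta>S = real (a * c + a + D) / real ((a + c + D) * (c + D + 1))"
  define \<eta>T where "\<eta>T = real (c * a + c + D) / real ((c + a + D) * (a + D + 1))"
  have a1: "1 \<le> real a" and c1: "1 \<le> real c" using a c by auto
  have D01: "real D = 0 \<or> 1 \<le> real D" by auto
  have m2: "2 \<le> m" using a1 c1 by (simp add: m_def)
  have mnat: "m = real (a + c + D)" by (simp add: m_def)
  have ac: "real a * real c \<le> m\<^sup>2 / 4"
  proof -
    have "0 \<le> (real a - real c)\<^sup>2" by simp
    then have "4 * (real a * real c) \<le> (real a + real c)\<^sup>2" by (simp add: power2_eq_square algebra_simps)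
    also have "\<dots> \<le> m\<^sup>2" unfolding m_def by (intro power_mono) auto
    finally show ?thesis by simp
  qed
  have m2p: "0 < m\<^sup>2" using m2 by simp
  have R0: "0 < R" using E by (simp add: R_def power2_eq_square algebra_simps)
  have k0: "0 < \<kappa>" using R0 m2p by (simp add: \<kappa>_def)
  have k1: "\<kappa> < 1"
  proof -
    have "R < m\<^sup>2" using ac m2p zero_le_power2[of "real D + 1"] unfolding R_def by linarith
    then show ?thesis using m2p by (simp add: \<kappa>_def)
  qed
  have q0: "0 < q" using k0 by (simp add: q_def)
  have q1: "q < 1" using k1 by (simp add: q_def)
  have q2: "q\<^sup>2 = \<kappa>" using k0 by (simp add: q_def)
  have q3: "q ^ 3 = sqrt R ^ 3 / m ^ 3"
    using m2 by (simp add: q_def \<kappa>_def real_sqrt_divide power_divide)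
  have e0: "0 < e" using E m2p by (simp add: e_def m_def[symmetric])
  have e1: "e < 1"
  proof -
    have "real a * real c - (real D)\<^sup>2 / 4 < m\<^sup>2"
      using ac m2p zero_le_power2[of "real D"] by linarith
    then show ?thesis using m2p by (simp add: e_def m_def[symmetric])
  qed
  have e3: "e ^ 3 = (real a * real c - (real D)\<^sup>2 / 4) ^ 3 / m ^ 6"
    by (simp add: e_def m_def power_divide flip: power_mult)
  note margin = degree_margin_bound[OF a1 c1 D01 E, folded R_def m_def]
  have S_margin: "(real a + real D) / real c * e ^ 3 \<le> \<eta>S * q ^ 3"
  proof -
    have "(real a + real D) / real c * e ^ 3
      = ((real a + real D) * (real c + real D + 1) * (real a * real c - (real D)\<^sup>2 / 4) ^ 3)
        / (real c * (real c + real D + 1) * m ^ 6)"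
      unfolding e3 using c1 by (simp add: divide_simps)
    also have "\<dots> \<le> (real c * (real a * real c + real a + real D) * m\<^sup>2 * sqrt R ^ 3)
        / (real c * (real c + real D + 1) * m ^ 6)"
      using margin(1) m2 by (intro divide_right_mono) auto
    also have "\<dots> = \<eta>S * q ^ 3"
    proof -
      have eq: "\<eta>S = (real a * real c + real a + real D) / (m * (real c + real D + 1))"
        unfolding \<eta>S_def of_nat_mult[of "a + c + D"] by (simp add: m_def add_ac)
      show ?thesis
        unfolding eq q3 using m2 c1 by (simp add: divide_simps power2_eq_square numeral_eq_Suc)
    qed
    finally show ?thesis .
  qed
  have T_margin: "e ^ 3 \<le> \<eta>T * q ^ 3"
  proof -
    have "e ^ 3 = ((real a + real D + 1) * (real a * real c - (real D)\<^sup>2 / 4) ^ 3)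
        / ((real a + real D + 1) * m ^ 6)"
      unfolding e3 using a1 by (simp add: divide_simps)
    also have "\<dots> \<le> ((real a * real c + real c + real D) * m\<^sup>2 * sqrt R ^ 3)
        / ((real a + real D + 1) * m ^ 6)"
      using margin(2) m2 by (intro divide_right_mono) auto
    also have "\<dots> = \<eta>T * q ^ 3"
    proof -
      have eq: "\<eta>T = (real a * real c + real c + real D) / (m * (real a + real D + 1))"
        unfolding \<eta>T_def of_nat_mult[of "c + a + D"] by (simp add: m_def mult.commute add_ac)
      show ?thesis
        unfolding eq q3 using m2 by (simp add: divide_simps power2_eq_square numeral_eq_Suc)
    qed
    finally show ?thesis .
  qed
  have \<eta>S: "0 < \<eta>S" and \<eta>T: "0 < \<eta>T"
    using a c unfolding \<eta>S_def \<eta>T_def by (auto intro!: divide_pos_pos simp del: of_nat_mult of_nat_add)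
  have \<eta>S1: "\<eta>S \<le> 1"
  proof -
    have "a * c + a + D \<le> (a + c + D) * (c + D + 1)" by (simp add: algebra_simps)
    then have "real (a * c + a + D) \<le> real ((a + c + D) * (c + D + 1))" by (simp only: of_nat_le_iff)
    then show ?thesis using a unfolding \<eta>S_def by (simp add: divide_le_eq_1 del: of_nat_mult of_nat_add)
  qed
  have q3lt: "q ^ 3 < 1" using q0 q1 by (simp add: power_less_one_iff)

  \<comment> \<open>The vertices with the largest and smallest entries\<close>
  obtain P where P: "P \<in> V" "\<And>k. k \<in> V \<Longrightarrow> x k \<le> x P"
  proof -
    have "Max (x ` V) \<in> x ` V" using fin ij by (intro Max_in) auto
    then obtain P where "P \<in> V" "x P = Max (x ` V)" by auto
    then show ?thesis using fin that by (metis Max_ge finite_imageI imageI)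
  qed
  \<comment> \<open>Minimizing over \<open>V - {P}\<close> keeps \<open>Q\<close> different from
    \<open>P\<close> even if all entries coincide; the minimum over all of \<open>V\<close> is the
    same.\<close>
  obtain Q where Q: "Q \<in> V" "Q \<noteq> P" "\<And>k. k \<in> V \<Longrightarrow> x Q \<le> x k"
  proof -
    have ne: "V - {P} \<noteq> {}" using ij by blast
    have "Min (x ` (V - {P})) \<in> x ` (V - {P})" using fin ne by (intro Min_in) auto
    then obtain Q where Q: "Q \<in> V - {P}" "x Q = Min (x ` (V - {P}))" by (metis imageE)
    have "x Q \<le> x k" if "k \<in> V" for k
    proof (cases "k = P")
      case True then show ?thesis using P(2)[of Q] Q(1) by simp
    next
      case False then show ?thesis using fin that Q by auto
    qed
    then show ?thesis using Q that by auto
  qed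
  have xP: "1 < x P * e ^ 3"
  proof -
    have "x i * x j \<le> x P * x P"
      using P ij pos by (intro mult_mono) (auto intro: less_imp_le)
    then have "x i * x j * e ^ 6 \<le> x P * x P * e ^ 6" using e0 by (intro mult_right_mono) auto
    also have "x P * x P * e ^ 6 = (x P * e ^ 3)\<^sup>2"
      by (simp add: power_mult_distrib power2_eq_square[of "x P"] flip: power_mult)
    finally have "1 < (x P * e ^ 3)\<^sup>2" using big by simp
    then show ?thesis using e0 pos[OF P(1)]
      by (metis abs_of_pos mult_pos_pos one_power2 power2_le_iff_abs_le not_less zero_less_power zero_le_one)
  qed
  have e3lt: "e ^ 3 < 1" using e0 e1 by (simp add: power_less_one_iff)
  have xP1: "1 < x P"
    using xP e3lt pos[OF P(1)] by (smt (verit) mult_less_cancel_left1 mult_left_le)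
  have cardV: "card (V - {k}) = a + c + D" if "k \<in> V" for k using that card fin by simp
  have pp: "0 < x k * x l" if "k \<in> V" "l \<in> V" for k l using that pos by simp
  have rowP: "(\<Sum>j\<in>V - {P}. edge_prob (x P * x j)) \<le> real (a + D)" using upper[OF P(1) xP1] by simp
  \<comment> \<open>The entry at \<open>Q\<close> is the smallest of row \<open>P\<close>, hence at
    most the average of that row.\<close>
  have zPQ: "edge_prob (x P * x Q) \<le> (real a + real D) / m"
  proof -
    have "(\<Sum>j\<in>V - {P}. edge_prob (x P * x Q)) \<le> (\<Sum>j\<in>V - {P}. edge_prob (x P * x j))"
      using P Q pp pos by (intro sum_mono edge_prob_mono mult_left_mono) (auto intro: less_imp_le)
    then have "m * edge_prob (x P * x Q) \<le> real a + real D" using rowP cardV[OF P(1)] by (simp add: mnat)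
    then show ?thesis using m2 by (simp add: field_simps)
  qed
  have oPQ: "x P * x Q \<le> (real a + real D) / real c"
  proof -
    have 1: "0 < 1 + x P * x Q" using pp[OF P(1) Q(1)] by simp
    have "x P * x Q * m \<le> (real a + real D) * (1 + x P * x Q)"
      using zPQ 1 m2 unfolding edge_prob_def by (simp add: divide_simps mult_ac)
    then have "x P * x Q * real c \<le> real a + real D" by (simp add: m_def algebra_simps)
    then show ?thesis using c1 by (simp add: field_simps)
  qed
  \<comment> \<open>A large \<open>x P\<close> together with bounded odds of the pair
    \<open>P\<close>, \<open>Q\<close> forces \<open>x Q\<close> to be tiny.\<close>
  have xQ: "x Q \<le> \<eta>S * q ^ 3"
  proof -
    have "x Q \<le> x Q * (x P * e ^ 3)" using xP pos[OF Q(1)] by simp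
    also have "\<dots> = (x P * x Q) * e ^ 3" by simp
    also have "\<dots> \<le> (real a + real D) / real c * e ^ 3" using oPQ e0 by (intro mult_right_mono) auto
    finally show ?thesis using S_margin by simp
  qed
  have xQ1: "x Q < 1"
  proof -
    have "\<eta>S * q ^ 3 \<le> q ^ 3" using \<eta>S1 q0 by (intro mult_left_le_one_le) (auto simp: \<eta>S less_imp_le)
    then show ?thesis using xQ q3lt by simp
  qed
  have xPT: "1 \<le> x P * (\<eta>T * q ^ 3)"
  proof -
    have "x P * e ^ 3 \<le> x P * (\<eta>T * q ^ 3)"
      using T_margin pos[OF P(1)] by (intro mult_left_mono) auto
    then show ?thesis using xP by linarith
  qed
  have rowQ: "real a \<le> (\<Sum>j\<in>V - {Q}. edge_prob (x Q * x j))" using lower[OF Q(1) xQ1] by simp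

  \<comment> \<open>The far vertices\<close>
  define S' where "S' = {k \<in> V - {Q}. \<eta>S \<le> edge_prob (x Q * x k)}"
  define T' where "T' = {k \<in> V - {P}. \<eta>T \<le> 1 - edge_prob (x P * x k)}"
  have cS': "a \<le> card S'"
    unfolding S'_def \<eta>S_def
  proof (rule many_large_terms[OF _ _ rowQ _ a])
    fix k assume k: "k \<in> V - {Q}"
    have "edge_prob (x Q * x k) \<le> edge_prob (x P * x Q)"
      using k P Q pos pp by (subst mult.commute, intro edge_prob_mono mult_right_mono) (auto intro: less_imp_le)
    then show "edge_prob (x Q * x k) \<le> real (a + D) / real (a + c + D)" using zPQ by (simp add: m_def)
  qed (use fin cardV Q in auto)
  have cT': "c \<le> card T'"
    unfolding T'_def \<eta>T_def
  proof (rule many_large_terms[OF _ _ _ _ c])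
    have "(\<Sum>k\<in>V - {P}. 1 - edge_prob (x P * x k)) = m - (\<Sum>k\<in>V - {P}. edge_prob (x P * x k))"
      using cardV[OF P(1)] by (simp add: sum_subtractf m_def)
    then show "real c \<le> (\<Sum>k\<in>V - {P}. 1 - edge_prob (x P * x k))" using rowP by (simp add: m_def)
  next
    fix k assume k: "k \<in> V - {P}"
    \<comment> \<open>Each entry of row \<open>Q\<close> has odds at most \<open>x P * x k\<close>,
      as \<open>x Q\<close> is minimal and \<open>x P\<close> maximal. Thus the row sum bound at
      \<open>Q\<close> carries over to a single entry of row \<open>P\<close>.\<close>
    have "real a \<le> (\<Sum>j\<in>V - {Q}. edge_prob (x P * x k))"
    proof -
      have "edge_prob (x Q * x j) \<le> edge_prob (x P * x k)" if "j \<in> V - {Q}" for j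
      proof (rule edge_prob_mono)
        show "0 \<le> x Q * x j" using that pp Q by (simp add: less_imp_le)
        have "x Q * x j \<le> x k * x P"
          using that k P Q pos by (intro mult_mono) (auto intro: less_imp_le)
        then show "x Q * x j \<le> x P * x k" by (simp add: mult.commute)
      qed
      then have "(\<Sum>j\<in>V - {Q}. edge_prob (x Q * x j)) \<le> (\<Sum>j\<in>V - {Q}. edge_prob (x P * x k))"
        by (rule sum_mono)
      then show ?thesis using rowQ by simp
    qed
    then have "real a \<le> m * edge_prob (x P * x k)" using cardV[OF Q(1)] by (simp add: mnat)
    then have "real a / m \<le> edge_prob (x P * x k)" using m2 by (simp add: field_simps)
    moreover have "real (c + D) / real (c + a + D) = 1 - real a / m" using m2 by (simp add: m_def field_simps)
    ultimately show "1 - edge_prob (x P * x k) \<le> real (c + D) / real (c + a + D)" by simp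
  qed (use fin cardV P in auto)

  \<comment> \<open>The odds of \<open>Q\<close> and \<open>k\<close> are at least
    \<open>\<eta>S\<close>, while \<open>x Q\<close> is at most \<open>\<eta>S * q^3\<close>; the
    quotient bounds \<open>x k\<close>.\<close>
  have S'far: "1 / q ^ 3 \<le> x k" if "k \<in> S'" for k
  proof -
    have k: "k \<in> V" "\<eta>S \<le> edge_prob (x Q * x k)" using that by (auto simp: S'_def)
    have "\<eta>S \<le> x Q * x k" using k edge_prob_le[of "x Q * x k"] pp[OF Q(1) k(1)] by simp
    also have "\<dots> \<le> \<eta>S * q ^ 3 * x k" using xQ pos[OF k(1)] by (intro mult_right_mono) auto
    finally have "1 \<le> q ^ 3 * x k" using \<eta>S by simp
    then show ?thesis using q0 by (simp add: field_simps)
  qed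
  have T'far: "x k \<le> q ^ 3" if "k \<in> T'" for k
  proof -
    have k: "k \<in> V" "\<eta>T \<le> 1 - edge_prob (x P * x k)" using that by (auto simp: T'_def)
    have o: "0 < x P * x k" using pp[OF P(1) k(1)] .
    have "\<eta>T \<le> 1 / (x P * x k)"
      using k o edge_prob_le[of "1 / (x P * x k)"] by (simp add: one_minus_edge_prob)
    then have "\<eta>T * x k * x P \<le> 1" using o by (simp add: field_simps)
    also have "\<dots> \<le> \<eta>T * q ^ 3 * x P" using xPT by (simp add: mult_ac)
    finally show ?thesis using \<eta>T pos[OF P(1)] by (simp add: mult_le_cancel_right mult_le_cancel_left)
  qed
  have qq: "q ^ 3 \<le> q" using q0 q1 power_decreasing[of 1 3 q] by simp
  \<comment> \<open>The thresholds are reciprocal, so pairs between \<open>S\<close> and \<open>U\<close> have odds at least 1 and pairs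
    between \<open>T\<close> and \<open>U\<close> odds at most 1; the far sets \<open>S'\<close>, \<open>T'\<close> gain a factor \<open>q\<^sup>2 = \<kappa>\<close>.\<close>
  define S where "S = {k \<in> V. 1 / q \<le> x k}"
  define T where "T = {k \<in> V. x k \<le> q}"
  define U where "U = V - S - T"
  have S'S: "S' \<subseteq> S"
  proof
    fix k assume "k \<in> S'"
    moreover have "1 / q \<le> 1 / q ^ 3" using qq q0 by (simp add: frac_le)
    ultimately show "k \<in> S" using S'far[of k] by (auto simp: S_def S'_def)
  qed
  have T'T: "T' \<subseteq> T" using T'far qq by (force simp: T_def T'_def)
  have qlt: "q < 1 / q" by (rule less_trans[OF q1]) (use q0 q1 in simp)
  have disj: "S \<inter> T = {}" using qlt by (auto simp: S_def T_def)
  have fins: "finite S" "finite T" "finite U" using fin by (auto simp: S_def T_def U_def)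
  have VSTU: "V = S \<union> T \<union> U" "S \<inter> U = {}" "T \<inter> U = {}" by (auto simp: S_def T_def U_def)

  \<comment> \<open>Counting over the three classes\<close>
  define s t u where "s = real (card S)" and "t = real (card T)" and "u = real (card U)"
  have aS: "real a \<le> card S'" "real (card S') \<le> s" and cT: "real c \<le> card T'" "real (card T') \<le> t"
    using cS' cT' S'S T'T fins by (auto simp: s_def t_def card_mono)
  have stu: "s + t + u = m + 1"
  proof -
    have "card V = card S + card T + card U"
      using VSTU disj fins by (metis Int_Un_distrib2 card_Un_disjoint finite_UnI sup_bot.right_neutral)
    then show ?thesis using card by (simp add: s_def t_def u_def m_def)
  qed
  have xpos: "0 < x k" if "k \<in> S \<union> T \<union> U" for k using that VSTU pos by auto
  have xS: "1 / q \<le> x k" if "k \<in> S" for k using that by (simp add: S_def)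
  have xT: "x k \<le> q" if "k \<in> T" for k using that by (simp add: T_def)
  have xU: "q \<le> x k" "x k \<le> 1 / q" if "k \<in> U" for k using that by (auto simp: U_def S_def T_def)
  define z where "z k l = edge_prob (x k * x l)" for k l
  \<comment> \<open>Row \<open>k\<close> would contribute \<open>m - t\<close> over \<open>S\<close>
    and \<open>U\<close> if all these entries were 1. The deficits are at most \<kappa> each, except
    that pairs with \<open>U\<close> may cost 1/2 when \<open>k\<close> is not far.\<close>
  have rowS: "(m - t) * (1 - \<kappa>) - (a + D) + (\<Sum>j\<in>T. z k j) \<le> (if k \<in> S' then 0 else u / 2)"
    if k: "k \<in> S" for k
  proof -
    have kV: "k \<in> V" "k \<notin> T" "k \<notin> U" using k VSTU disj by auto
    have "1 < 1 / q" using q0 q1 by simp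
    then have "1 < x k" using xS[OF k] by linarith
    then have row: "(\<Sum>j\<in>V - {k}. z k j) \<le> a + D" using upper[OF kV(1)] by (simp add: z_def)
    have "V - {k} = (S \<union> U - {k}) \<union> T" using VSTU k kV by auto
    moreover have "(S \<union> U - {k}) \<inter> T = {}" using VSTU disj by auto
    ultimately have split: "(\<Sum>j\<in>V - {k}. z k j) = (\<Sum>j\<in>S \<union> U - {k}. z k j) + (\<Sum>j\<in>T. z k j)"
      using fins by (simp add: sum.union_disjoint)
    have cSU: "real (card (S \<union> U - {k})) = m - t"
    proof -
      have "card (S \<union> U) = card S + card U" using VSTU fins by (simp add: card_Un_disjoint)
      moreover have "card (S \<union> U) = Suc (card (S \<union> U - {k}))"
        using k fins by (metis UnI1 card_Suc_Diff1 finite_UnI)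
      ultimately have "real (card (S \<union> U - {k})) = s + u - 1" by (simp add: s_def u_def)
      then show ?thesis using stu by simp
    qed
    have "(\<Sum>j\<in>S \<union> U - {k}. 1 - z k j) = m - t - (\<Sum>j\<in>S \<union> U - {k}. z k j)"
      using cSU by (simp add: sum_subtractf)
    moreover have "(\<Sum>j\<in>S \<union> U - {k}. 1 - z k j)
      \<le> \<kappa> * (real (card S) + card U - 1) + (if k \<in> S' then 0 else card U / 2)"
    proof (rule sum_near_far_le)
      fix j assume j: "j \<in> S"
      have "1 / q * (1 / q) \<le> x k * x j"
        using xS[OF k] xS[OF j] q0 by (intro mult_mono) (auto intro: order_trans[of _ "1 / q"])
      then have "1 / \<kappa> \<le> x k * x j" using q2 by (simp add: power2_eq_square)
      then show "1 - z k j \<le> \<kappa>" unfolding z_def using k0 by (rule one_minus_edge_prob_le[rotated])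
    next
      fix j assume j: "j \<in> U"
      show "1 - z k j \<le> (if k \<in> S' then \<kappa> else 1 / 2)"
      proof (cases "k \<in> S'")
        case True
        have "1 / q ^ 3 * q \<le> x k * x j"
          using S'far[OF True] xU[OF j] q0 xpos k by (intro mult_mono) (auto intro: less_imp_le)
        moreover have "1 / q ^ 3 * q = 1 / \<kappa>" unfolding q2[symmetric] using q0
          by (simp add: power2_eq_square numeral_eq_Suc)
        ultimately have "1 / \<kappa> \<le> x k * x j" by simp
        then show ?thesis using True k0 by (simp add: z_def one_minus_edge_prob_le)
      next
        case False
        have "1 / q * q \<le> x k * x j"
          using xS[OF k] xU[OF j] q0 xpos k by (intro mult_mono) (auto intro: less_imp_le)
        then have "1 \<le> x k * x j" using q0 by simp
        then show ?thesis using False one_minus_edge_prob_le_half unfolding z_def by auto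
      qed
    qed (use fins VSTU k k0 in auto)
    moreover have "real (card S) + card U - 1 = m - t" using stu by (simp add: s_def u_def)
    ultimately show ?thesis using row split by (simp add: u_def algebra_simps split: if_splits)
  qed
  have rowT: "a - \<kappa> * (m - s) - (\<Sum>j\<in>S. z k j) \<le> (if k \<in> T' then 0 else u / 2)"
    if k: "k \<in> T" for k
  proof -
    have kV: "k \<in> V" "k \<notin> S" "k \<notin> U" using k VSTU disj by auto
    have "x k < 1" using xT[OF k] q1 by simp
    then have row: "a \<le> (\<Sum>j\<in>V - {k}. z k j)" using lower[OF kV(1)] by (simp add: z_def)
    have o: "0 \<le> x k * x j" if "j \<in> T \<union> U" for j
      using xpos[of k] xpos[of j] k that by (simp add: less_imp_le)
    have "V - {k} = (T \<union> U - {k}) \<union> S" using VSTU k kV by auto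
    moreover have "(T \<union> U - {k}) \<inter> S = {}" using VSTU disj by auto
    ultimately have split: "(\<Sum>j\<in>V - {k}. z k j) = (\<Sum>j\<in>T \<union> U - {k}. z k j) + (\<Sum>j\<in>S. z k j)"
      using fins by (simp add: sum.union_disjoint)
    have "(\<Sum>j\<in>T \<union> U - {k}. z k j) \<le> \<kappa> * (real (card T) + card U - 1) + (if k \<in> T' then 0 else card U / 2)"
    proof (rule sum_near_far_le)
      fix j assume j: "j \<in> T"
      have "x k * x j \<le> q * q"
        using xT[OF k] xT[OF j] q0 xpos j by (intro mult_mono) (auto intro: less_imp_le)
      then have "x k * x j \<le> \<kappa>" using q2 by (simp add: power2_eq_square)
      then show "z k j \<le> \<kappa>" unfolding z_def
        using edge_prob_le[OF o[of j]] j by simp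
    next
      fix j assume j: "j \<in> U"
      show "z k j \<le> (if k \<in> T' then \<kappa> else 1 / 2)"
      proof (cases "k \<in> T'")
        case True
        have "x k * x j \<le> q ^ 3 * (1 / q)"
          using T'far[OF True] xU[OF j] q0 xpos j by (intro mult_mono) (auto intro: less_imp_le)
        also have "\<dots> = \<kappa>" unfolding q2[symmetric] using q0
          by (simp add: power2_eq_square numeral_eq_Suc)
        finally show ?thesis
          using True edge_prob_le[OF o[of j]] j by (simp add: z_def)
      next
        case False
        have "x k * x j \<le> q * (1 / q)"
          using xT[OF k] xU[OF j] q0 xpos j by (intro mult_mono) (auto intro: less_imp_le)
        then have "x k * x j \<le> 1" using q0 by simp
        then show ?thesis using False edge_prob_le_half[OF o[of j]] j by (simp add: z_def)
      qed
    qed (use fins VSTU k k0 in auto)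
    moreover have "real (card T) + card U - 1 = m - s" using stu by (simp add: t_def u_def)
    ultimately show ?thesis using row split by (simp add: u_def algebra_simps split: if_splits)
  qed
  have card_diff: "(\<Sum>k\<in>A. if k \<in> B then 0 else u / 2) = (real (card A) - card B) * u / 2"
    if "B \<subseteq> A" "finite A" for A B :: "'a set"
  proof -
    have "(\<Sum>k\<in>A. if k \<in> B then 0 else u / 2) = (\<Sum>k\<in>A - B. u / 2)"
      using that by (intro sum.mono_neutral_cong_right) auto
    also have "\<dots> = (real (card A) - card B) * u / 2"
      using that by (simp add: card_Diff_subset finite_subset of_nat_diff card_mono)
    finally show ?thesis .
  qed
  have u0: "0 \<le> u" by (simp add: u_def)
  have "(\<Sum>k\<in>S. (m - t) * (1 - \<kappa>) - (a + D) + (\<Sum>j\<in>T. z k j))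
      \<le> (\<Sum>k\<in>S. if k \<in> S' then 0 else u / 2)"
    by (intro sum_mono rowS)
  also have "\<dots> = (s - card S') * u / 2" using card_diff[OF S'S fins(1)] by (simp add: s_def)
  also have "\<dots> \<le> (s - a) * u / 2" using aS u0 by (intro divide_right_mono mult_right_mono) auto
  finally have sumS: "s * ((m - t) * (1 - \<kappa>) - (a + D)) + (\<Sum>k\<in>S. \<Sum>j\<in>T. z k j) \<le> (s - a) * u / 2"
    by (simp add: sum.distrib s_def)
  have "(\<Sum>k\<in>T. a - \<kappa> * (m - s) - (\<Sum>j\<in>S. z k j))
      \<le> (\<Sum>k\<in>T. if k \<in> T' then 0 else u / 2)"
    by (intro sum_mono rowT)
  also have "\<dots> = (t - card T') * u / 2" using card_diff[OF T'T fins(2)] by (simp add: t_def)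
  also have "\<dots> \<le> (t - c) * u / 2" using cT u0 by (intro divide_right_mono mult_right_mono) auto
  finally have sumT: "t * (a - \<kappa> * (m - s)) - (\<Sum>k\<in>T. \<Sum>j\<in>S. z k j) \<le> (t - c) * u / 2"
    by (simp add: sum_subtractf t_def)
  \<comment> \<open>The block between \<open>S\<close> and \<open>T\<close> enters
    \<open>sumS\<close> and \<open>sumT\<close> with opposite signs and cancels, so its entries need
    no estimate.\<close>
  have "(\<Sum>k\<in>T. \<Sum>j\<in>S. z k j) = (\<Sum>k\<in>S. \<Sum>j\<in>T. z k j)"
    by (subst sum.swap) (simp add: z_def mult.commute)
  then have "s * ((m - t) * (1 - \<kappa>) - (a + D)) + t * (a - \<kappa> * (m - s)) \<le> (s - a) * u / 2 + (t - c) * u / 2"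
    using sumS sumT by simp
  then have 1: "a * c - (s - a) * (t - c) - ((s - a) + (t - c)) * u / 2 \<le> \<kappa> * (s * (m - t) + t * (m - s))"
    by (simp add: m_def algebra_simps add_divide_distrib diff_divide_distrib)
  \<comment> \<open>The excesses \<open>s - a\<close>, \<open>t - c\<close> and \<open>u\<close> add
    up to \<open>D + 1\<close>; this sum of squares shows that no distribution among them pushes the
    count below \<open>R\<close>.\<close>
  have "0 \<le> ((s - a) - (t - c))\<^sup>2 + u\<^sup>2" by simp
  also have "\<dots> = ((s - a) + (t - c) + u)\<^sup>2 - 4 * ((s - a) * (t - c)) - 2 * (((s - a) + (t - c)) * u)"
    by (simp add: power2_eq_square algebra_simps)
  also have "(s - a) + (t - c) + u = real D + 1" using stu by (simp add: m_def)
  finally have 2: "R \<le> a * c - (s - a) * (t - c) - ((s - a) + (t - c)) * u / 2" by (simp add: R_def)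
  \<comment> \<open>Strictness comes from excluding the diagonal: \<open>s + t\<close> is at most
    \<open>m + 1\<close>, and \<open>(m + 1) * (m - 1) = m^2 - 1\<close>.\<close>
  have "s * (m - t) + t * (m - s) < m\<^sup>2"
  proof -
    have "1 \<le> s" "1 \<le> t" using aS cT a1 c1 by auto
    then have "s * (m - t) + t * (m - s) \<le> s * (m - 1) + t * (m - 1)"
      by (intro add_mono mult_left_mono) auto
    also have "\<dots> = (s + t) * (m - 1)" by (simp add: algebra_simps)
    also have "\<dots> \<le> (m + 1) * (m - 1)" using stu u0 m2 by (intro mult_right_mono) auto
    also have "\<dots> < m\<^sup>2" by (simp add: power2_eq_square algebra_simps)
    finally show ?thesis .
  qed
  then have "\<kappa> * (s * (m - t) + t * (m - s)) < \<kappa> * m\<^sup>2" using k0 by simp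
  also have "\<kappa> * m\<^sup>2 = R" using m2p by (simp add: \<kappa>_def)
  finally show False using 1 2 by simp
qed

text \<open>Inverting \<open>x\<close> replaces every entry by its complement to 1, so the two row
  hypotheses trade places along with \<open>a\<close> and \<open>c\<close>. The quantity
  \<open>e\<close> is symmetric in \<open>a\<close> and \<open>c\<close>.\<close>

lemma edge_odds_bounds:
  fixes V :: "'a set" and x :: "'a \<Rightarrow> real" and a c D :: nat
  assumes fin: "finite V" and card: "card V = a + c + D + 1"
    and a: "1 \<le> a" and c: "1 \<le> c"
    and pos: "\<And>i. i \<in> V \<Longrightarrow> 0 < x i"
    and upper: "\<And>i. i \<in> V \<Longrightarrow> 1 < x i \<Longrightarrow> (\<Sum>j\<in>V - {i}. edge_prob (x i * x j)) \<le> a + D"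
    and lower: "\<And>i. i \<in> V \<Longrightarrow> x i < 1 \<Longrightarrow> a \<le> (\<Sum>j\<in>V - {i}. edge_prob (x i * x j))"
    and E: "real D + 3 / 4 \<le> real a * real c - (real D)\<^sup>2 / 4"
    and ij: "i \<in> V" "j \<in> V" "i \<noteq> j"
  defines "e \<equiv> (real a * real c - (real D)\<^sup>2 / 4) / (real a + real c + real D)\<^sup>2"
  shows "x i * x j * e ^ 6 \<le> 1" and "e ^ 6 \<le> x i * x j"
proof -
  show "x i * x j * e ^ 6 \<le> 1"
    unfolding e_def by (rule edge_odds_upper_bound[OF fin card a c pos upper lower E ij])
  have row: "(\<Sum>j\<in>V - {k}. edge_prob (1 / x k * (1 / x j))) = real (a + c + D) - (\<Sum>j\<in>V - {k}. edge_prob (x k * x j))"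
    if "k \<in> V" for k
  proof -
    have "(\<Sum>j\<in>V - {k}. edge_prob (1 / x k * (1 / x j))) = (\<Sum>j\<in>V - {k}. 1 - edge_prob (x k * x j))"
      using that pos by (intro sum.cong refl) (simp add: one_minus_edge_prob)
    also have "\<dots> = real (card (V - {k})) - (\<Sum>j\<in>V - {k}. edge_prob (x k * x j))"
      by (simp add: sum_subtractf)
    also have "card (V - {k}) = a + c + D" using that fin card by simp
    finally show ?thesis .
  qed
  have "1 / x i * (1 / x j) * ((real c * real a - (real D)\<^sup>2 / 4) / (real c + real a + real D)\<^sup>2) ^ 6 \<le> 1"
  proof (rule edge_odds_upper_bound[OF fin _ c a _ _ _ _ ij, where x = "\<lambda>k. 1 / x k"])
    show "(\<Sum>j\<in>V - {k}. edge_prob (1 / x k * (1 / x j))) \<le> real (c + D)" if "k \<in> V" "1 < 1 / x k" for k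
      using that row[of k] lower[of k] pos[of k] by simp
    show "real c \<le> (\<Sum>j\<in>V - {k}. edge_prob (1 / x k * (1 / x j)))" if "k \<in> V" "1 / x k < 1" for k
      using that row[of k] upper[of k] pos[of k] by simp
  qed (use card pos E in \<open>auto simp: mult.commute\<close>)
  then have "1 / x i * (1 / x j) * e ^ 6 \<le> 1" by (simp add: e_def mult.commute add.commute)
  then show "e ^ 6 \<le> x i * x j" using pos ij by (simp add: field_simps)
qed


section \<open>Duality and Gibbs' inequality\<close>

lemma finite_pairs: "finite (pairs n)"
proof -
  have "pairs n \<subseteq> Pow {1..n}" by (auto simp: pairs_def)
  then show ?thesis by (rule finite_subset) simp
qed

lemma pairs_subset: "e \<in> pairs n \<Longrightarrow> e \<subseteq> {1..n}"
  by (auto simp: pairs_def)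

lemma finite_edge: "e \<in> pairs n \<Longrightarrow> finite e"
  by (auto simp: pairs_def)

lemma sum_incident_pairs:
  assumes "k \<in> {1..n}"
  shows "(\<Sum>e\<in>pairs n. if k \<in> e then g e else 0) = (\<Sum>j\<in>{1..n} - {k}. g {j, k})"
proof -
  have "(\<Sum>e\<in>pairs n. if k \<in> e then g e else 0) = (\<Sum>e\<in>{e \<in> pairs n. k \<in> e}. g e)"
    by (simp add: sum.inter_filter finite_pairs)
  also have "{e \<in> pairs n. k \<in> e} = (\<lambda>j. {j, k}) ` ({1..n} - {k})"
    using assms unfolding pairs_def by (fastforce simp: insert_commute)
  also have "(\<Sum>e\<in>(\<lambda>j. {j, k}) ` ({1..n} - {k}). g e) = (\<Sum>j\<in>{1..n} - {k}. g {j, k})"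
    by (subst sum.reindex) (auto simp: inj_on_def doubleton_eq_iff)
  finally show ?thesis .
qed

lemma sum_pairs_swap:
  "(\<Sum>e\<in>pairs n. \<Sum>k\<in>e. f e k) = (\<Sum>k\<in>{1..n}. \<Sum>j\<in>{1..n} - {k}. f {j, k} k)"
proof -
  have "(\<Sum>k\<in>e. f e k) = (\<Sum>k\<in>{1..n}. if k \<in> e then f e k else 0)" if "e \<in> pairs n" for e
    using pairs_subset[OF that] by (simp add: sum.inter_restrict[symmetric] Int_absorb1 Int_absorb2 inf.absorb2)
  then have "(\<Sum>e\<in>pairs n. \<Sum>k\<in>e. f e k) = (\<Sum>e\<in>pairs n. \<Sum>k\<in>{1..n}. if k \<in> e then f e k else 0)"
    by simp
  also have "\<dots> = (\<Sum>k\<in>{1..n}. \<Sum>e\<in>pairs n. if k \<in> e then f e k else 0)"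
    by (rule sum.swap)
  also have "\<dots> = (\<Sum>k\<in>{1..n}. \<Sum>j\<in>{1..n} - {k}. f {j, k} k)"
    by (intro sum.cong refl sum_incident_pairs)
  finally show ?thesis .
qed

section \<open>The Lagrangian dual and its minimizer over a box\<close>

definition dual :: "nat \<Rightarrow> (nat \<Rightarrow> nat) \<Rightarrow> (nat \<Rightarrow> real) \<Rightarrow> real" where
  "dual n d l = (\<Sum>e\<in>pairs n. ln (1 + exp (\<Sum>k\<in>e. l k))) - (\<Sum>k\<in>{1..n}. d k * l k)"

lemma continuous_on_dual: "continuous_on UNIV (dual n d)"
proof -
  have "1 + exp s \<noteq> 0" for s :: real using exp_gt_zero[of s] by linarith
  then show ?thesis unfolding dual_def
    by (intro continuous_intros continuous_on_product_coordinates) auto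
qed

lemma DERIV_ln_one_plus_exp:
  assumes "(s has_real_derivative c) (at t)"
  shows "((\<lambda>t. ln (1 + exp (s t))) has_real_derivative edge_prob (exp (s t)) * c) (at t)"
  by (auto intro!: derivative_eq_intros assms simp: edge_prob_def add_pos_pos)

lemma dual_coordinate_derivative:
  assumes i: "i \<in> {1..n}"
  shows "((\<lambda>t. dual n d (l(i := t))) has_real_derivative
    (\<Sum>j\<in>{1..n} - {i}. edge_prob (exp (l i) * exp (l j))) - d i) (at (l i))"
proof -
  have coord: "((\<lambda>t. (l(i := t)) k) has_real_derivative (if k = i then 1 else 0)) (at (l i))" for k
    by (cases "k = i") (auto intro!: derivative_eq_intros)
  have edge: "((\<lambda>t. \<Sum>k\<in>e. (l(i := t)) k) has_real_derivative (if i \<in> e then 1 else 0)) (at (l i))"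
    if "e \<in> pairs n" for e
  proof -
    have "((\<lambda>t. \<Sum>k\<in>e. (l(i := t)) k) has_real_derivative (\<Sum>k\<in>e. if k = i then 1 else 0)) (at (l i))"
      by (intro DERIV_sum coord)
    then show ?thesis using finite_edge[OF that] by simp
  qed
  have "((\<lambda>t. ln (1 + exp (\<Sum>k\<in>e. (l(i := t)) k))) has_real_derivative
      (if i \<in> e then edge_prob (exp (\<Sum>k\<in>e. l k)) else 0)) (at (l i))"
    if e: "e \<in> pairs n" for e
  proof -
    show ?thesis using DERIV_ln_one_plus_exp[OF edge[OF e]] by (simp split: if_splits)
  qed
  then have "((\<lambda>t. \<Sum>e\<in>pairs n. ln (1 + exp (\<Sum>k\<in>e. (l(i := t)) k))) has_real_derivative
      (\<Sum>e\<in>pairs n. if i \<in> e then edge_prob (exp (\<Sum>k\<in>e. l k)) else 0)) (at (l i))"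
    by (rule DERIV_sum)
  moreover have "(\<Sum>e\<in>pairs n. if i \<in> e then edge_prob (exp (\<Sum>k\<in>e. l k)) else 0)
      = (\<Sum>j\<in>{1..n} - {i}. edge_prob (exp (l i) * exp (l j)))"
    by (subst sum_incident_pairs[OF i], intro sum.cong refl) (simp add: exp_add mult.commute)
  moreover have "((\<lambda>t. \<Sum>k\<in>{1..n}. d k * (l(i := t)) k) has_real_derivative
      (\<Sum>k\<in>{1..n}. real (d k) * (if k = i then 1 else 0))) (at (l i))"
    by (intro DERIV_sum DERIV_cmult coord)
  moreover have "(\<Sum>k\<in>{1..n}. real (d k) * (if k = i then 1 else 0)) = d i"
    using i by (simp add: if_distrib cong: if_cong)
  ultimately show ?thesis unfolding dual_def by (auto intro: DERIV_diff)
qed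

text \<open>Compactness gives a minimizer on the box without knowing that the dual is coercive. A
  coordinate off the lower face can still be decreased, so its partial derivative, row sum minus
  degree, is not positive; dually for the upper face.\<close>

lemma dual_box_minimizer:
  fixes n :: nat and d :: "nat \<Rightarrow> nat" and \<Lambda> :: real
  assumes "0 \<le> \<Lambda>"
  obtains l where
    "\<And>i. i \<in> {1..n} \<Longrightarrow> - \<Lambda> < l i \<Longrightarrow> (\<Sum>j\<in>{1..n} - {i}. edge_prob (exp (l i) * exp (l j))) \<le> d i"
    "\<And>i. i \<in> {1..n} \<Longrightarrow> l i < \<Lambda> \<Longrightarrow> d i \<le> (\<Sum>j\<in>{1..n} - {i}. edge_prob (exp (l i) * exp (l j)))"
proof -
  \<comment> \<open>Coordinates outside \<open>{1..n}\<close> do not affect the dual; pinning them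
    to 0 makes the box a product of compact sets.\<close>
  define K where "K k = (if k \<in> {1..n} then {- \<Lambda>..\<Lambda>} else {0})" for k :: nat
  define B where "B = Pi\<^sub>E UNIV K"
  have "compactin (product_topology (\<lambda>_. euclidean) UNIV) B"
    unfolding B_def compactin_PiE by (auto simp: K_def)
  then have "compact B" by (simp add: euclidean_product_topology)
  moreover have "(\<lambda>_. 0) \<in> B" using assms by (auto simp: B_def K_def)
  moreover have "continuous_on B (dual n d)" using continuous_on_dual continuous_on_subset by blast
  ultimately obtain l where l: "l \<in> B" and min: "\<And>y. y \<in> B \<Longrightarrow> dual n d l \<le> dual n d y"
    by (metis continuous_attains_inf empty_iff)
  have upd: "l(i := t) \<in> B" if "i \<in> {1..n}" "- \<Lambda> \<le> t" "t \<le> \<Lambda>" for i t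
    using l that by (auto simp: B_def K_def PiE_iff split: if_splits)
  have range: "- \<Lambda> \<le> l i" "l i \<le> \<Lambda>" if "i \<in> {1..n}" for i
    using l that by (auto simp: B_def K_def PiE_iff dest!: spec[of _ i])
  show ?thesis
  proof
    fix i assume i: "i \<in> {1..n}" and gt: "- \<Lambda> < l i"
    show "(\<Sum>j\<in>{1..n} - {i}. edge_prob (exp (l i) * exp (l j))) \<le> d i"
    proof (rule ccontr)
      assume "\<not> ?thesis"
      then obtain r where r: "0 < r" "\<And>h. 0 < h \<Longrightarrow> h < r \<Longrightarrow> dual n d (l(i := l i - h)) < dual n d (l(i := l i))"
        using DERIV_pos_inc_left[OF dual_coordinate_derivative[OF i, of d l]] by auto
      define h where "h = min (r / 2) (l i + \<Lambda>)"
      have "0 < h" "h < r" "h \<le> l i + \<Lambda>" using r gt by (auto simp: h_def)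
      then show False using r(2)[of h] min[OF upd[OF i, of "l i - h"]] range[OF i] by simp
    qed
  next
    fix i assume i: "i \<in> {1..n}" and lt: "l i < \<Lambda>"
    show "d i \<le> (\<Sum>j\<in>{1..n} - {i}. edge_prob (exp (l i) * exp (l j)))"
    proof (rule ccontr)
      assume "\<not> ?thesis"
      then obtain r where r: "0 < r" "\<And>h. 0 < h \<Longrightarrow> h < r \<Longrightarrow> dual n d (l(i := l i + h)) < dual n d (l(i := l i))"
        using DERIV_neg_dec_right[OF dual_coordinate_derivative[OF i, of d l]] by auto
      define h where "h = min (r / 2) (\<Lambda> - l i)"
      have "0 < h" "h < r" "h \<le> \<Lambda> - l i" using r lt by (auto simp: h_def)
      then show False using r(2)[of h] min[OF upd[OF i, of "l i + h"]] range[OF i] by simp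
    qed
  qed
qed

text \<open>This is \<open>ln u \<le> u - 1\<close> at \<open>u = z / x\<close>, multiplied by
  \<open>x\<close>. The linear term \<open>z - x\<close> is kept because it cancels against the one
  for \<open>1 - x\<close> and \<open>1 - z\<close>.\<close>

lemma gibbs_term:
  fixes x z :: real
  assumes "0 \<le> x" "0 < z"
  shows "x * ln (1 / x) \<le> x * ln (1 / z) + z - x"
    and "x \<noteq> z \<Longrightarrow> x * ln (1 / x) < x * ln (1 / z) + z - x"
proof -
  have *: "x * ln (z / x) = x * ln (1 / x) - x * ln (1 / z)" if "0 < x"
    using that assms by (simp add: ln_div algebra_simps)
  show "x * ln (1 / x) \<le> x * ln (1 / z) + z - x"
  proof (cases "x = 0")
    case False
    then have "x * ln (z / x) \<le> x * (z / x - 1)"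
      using assms by (intro mult_left_mono ln_le_minus_one) auto
    then show ?thesis using * False assms by (simp add: algebra_simps)
  qed (use assms in simp)
  assume ne: "x \<noteq> z"
  show "x * ln (1 / x) < x * ln (1 / z) + z - x"
  proof (cases "x = 0")
    case False
    then have p: "0 < z / x" "0 < x" using assms by auto
    moreover have "z / x \<noteq> 1" using ne False by simp
    ultimately have "ln (z / x) < z / x - 1"
      using ln_le_minus_one[of "z / x"] ln_eq_minus_one[of "z / x"] by fastforce
    then have "x * ln (z / x) < x * (z / x - 1)" using p by simp
    then show ?thesis using * False assms by (simp add: algebra_simps)
  qed (use assms in simp)
qed

lemma binary_entropy_less_cross_entropy:
  fixes x z :: real
  assumes "0 \<le> x" "x \<le> 1" "0 < z" "z < 1" "x \<noteq> z"
  shows "x * ln (1 / x) + (1 - x) * ln (1 / (1 - x)) < x * ln (1 / z) + (1 - x) * ln (1 / (1 - z))"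
  using gibbs_term(2)[of x z] gibbs_term(1)[of "1 - x" "1 - z"] assms by simp

lemma max_entropy_matrix_eq:
  fixes l :: "nat \<Rightarrow> real"
  assumes rows: "\<And>i. i \<in> {1..n} \<Longrightarrow> (\<Sum>j\<in>{1..n} - {i}. edge_prob (exp (l i) * exp (l j))) = d i"
  defines "z \<equiv> \<lambda>e\<in>pairs n. edge_prob (exp (\<Sum>k\<in>e. l k))"
  shows "z \<in> degree_polytope n d" and "max_entropy_matrix n d = z"
proof -
  have z01: "0 < z e" "z e < 1" if "e \<in> pairs n" for e
    using that by (auto simp: z_def edge_prob_def add_pos_pos divide_less_eq)
  have z_pair: "z {j, k} = edge_prob (exp (l k) * exp (l j))" if "j \<in> {1..n}" "k \<in> {1..n}" "j \<noteq> k" for j k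
  proof -
    have "{j, k} \<in> pairs n" using that by (auto simp: pairs_def)
    then show ?thesis using that by (simp add: z_def exp_add mult.commute)
  qed
  show zP: "z \<in> degree_polytope n d"
  proof -
    have "(\<Sum>j\<in>{1..n} - {k}. z {j, k}) = d k" if "k \<in> {1..n}" for k
    proof -
      have "(\<Sum>j\<in>{1..n} - {k}. z {j, k}) = (\<Sum>j\<in>{1..n} - {k}. edge_prob (exp (l k) * exp (l j)))"
        using that by (intro sum.cong refl z_pair) auto
      then show ?thesis using rows[OF that] by simp
    qed
    moreover have "z \<in> pairs n \<rightarrow>\<^sub>E UNIV" by (simp add: z_def)
    ultimately show ?thesis using z01 by (auto simp: degree_polytope_def less_imp_le)
  qed
  \<comment> \<open>The cross entropy relative to \<open>z\<close>. The log odds of \<open>z\<close>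
    are sums of vertex potentials, so \<open>C\<close> depends on \<open>x\<close> only through its
    row sums and is constant on the polytope.\<close>
  define C where "C x = (\<Sum>e\<in>pairs n. x e * ln (1 / z e) + (1 - x e) * ln (1 / (1 - z e)))" for x
  have C: "C x = (\<Sum>e\<in>pairs n. ln (1 + exp (\<Sum>k\<in>e. l k))) - (\<Sum>k\<in>{1..n}. l k * d k)"
    if x: "x \<in> degree_polytope n d" for x
  proof -
    have "x e * ln (1 / z e) + (1 - x e) * ln (1 / (1 - z e))
        = ln (1 + exp (\<Sum>k\<in>e. l k)) - (\<Sum>k\<in>e. l k * x e)" if "e \<in> pairs n" for e
    proof -
      define s where "s = (\<Sum>k\<in>e. l k)"
      have p: "0 < 1 + exp s" by (simp add: add_pos_pos)
      have "1 / z e = (1 + exp s) / exp s" "1 / (1 - z e) = 1 + exp s"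
        using that p by (simp_all add: z_def s_def[symmetric] edge_prob_def divide_simps)
      then have ln_z: "ln (1 / z e) = ln (1 + exp s) - s" "ln (1 / (1 - z e)) = ln (1 + exp s)"
        using p ln_divide_pos[of "1 + exp s" "exp s"] by simp_all
      have "(\<Sum>k\<in>e. l k * x e) = s * x e" by (simp add: s_def sum_distrib_right)
      then show ?thesis unfolding ln_z s_def[symmetric] by (simp add: algebra_simps)
    qed
    then have "C x = (\<Sum>e\<in>pairs n. ln (1 + exp (\<Sum>k\<in>e. l k))) - (\<Sum>e\<in>pairs n. \<Sum>k\<in>e. l k * x e)"
      unfolding C_def by (simp add: sum_subtractf)
    also have "(\<Sum>e\<in>pairs n. \<Sum>k\<in>e. l k * x e) = (\<Sum>k\<in>{1..n}. \<Sum>j\<in>{1..n} - {k}. l k * x {j, k})"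
      by (rule sum_pairs_swap)
    also have "\<dots> = (\<Sum>k\<in>{1..n}. l k * d k)"
      using x by (intro sum.cong refl) (simp add: degree_polytope_def flip: sum_distrib_left)
    finally show ?thesis .
  qed
  have less: "entropy n x < entropy n z" if x: "x \<in> degree_polytope n d" and ne: "x \<noteq> z" for x
  proof -
    have x01: "0 \<le> x e" "x e \<le> 1" if "e \<in> pairs n" for e
      using x that by (auto simp: degree_polytope_def)
    \<comment> \<open>Extensionality places the difference of the two points on an actual pair,
      where Gibbs' inequality is strict.\<close>
    obtain e where e: "e \<in> pairs n" "x e \<noteq> z e"
    proof -
      have "x \<in> extensional (pairs n)" "z \<in> extensional (pairs n)"
        using x zP by (auto simp: degree_polytope_def PiE_def)
      then show ?thesis using ne that extensionalityI by metis
    qed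
    have "entropy n x < C x"
      unfolding entropy_def C_def
    proof (rule sum_strict_mono_ex1[OF finite_pairs])
      show "\<forall>e\<in>pairs n. x e * ln (1 / x e) + (1 - x e) * ln (1 / (1 - x e))
          \<le> x e * ln (1 / z e) + (1 - x e) * ln (1 / (1 - z e))"
      proof
        fix e assume "e \<in> pairs n"
        then show "x e * ln (1 / x e) + (1 - x e) * ln (1 / (1 - x e))
          \<le> x e * ln (1 / z e) + (1 - x e) * ln (1 / (1 - z e))"
          using x01[of e] z01[of e] binary_entropy_less_cross_entropy[of "x e" "z e"]
          by (cases "x e = z e") auto
      qed
      show "\<exists>e\<in>pairs n. x e * ln (1 / x e) + (1 - x e) * ln (1 / (1 - x e))
          < x e * ln (1 / z e) + (1 - x e) * ln (1 / (1 - z e))"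
        using e x01[OF e(1)] z01[OF e(1)] binary_entropy_less_cross_entropy by blast
    qed
    also have "C x = C z" using C[OF x] C[OF zP] by simp
    also have "\<dots> = entropy n z" by (simp add: C_def entropy_def)
    finally show ?thesis .
  qed
  show "max_entropy_matrix n d = z"
    unfolding max_entropy_matrix_def
  proof (rule the_equality)
    show "is_arg_max (entropy n) (\<lambda>x. x \<in> degree_polytope n d) z"
      using zP less by (auto simp: is_arg_max_def) (metis less_asym less_irrefl)
  next
    fix y assume "is_arg_max (entropy n) (\<lambda>x. x \<in> degree_polytope n d) y"
    then show "y = z" using zP less by (auto simp: is_arg_max_def)
  qed
qed


section \<open>Tameness\<close>

lemma tame_of_degree_range:
  fixes n a c D :: nat and d :: "nat \<Rightarrow> nat" and \<epsilon> :: real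
  assumes n: "n = a + c + D + 1" and a: "1 \<le> a" and c: "1 \<le> c"
    and deg: "\<And>i. i \<in> {1..n} \<Longrightarrow> a \<le> d i \<and> d i \<le> a + D"
    and E: "real D + 3 / 4 \<le> real a * real c - (real D)\<^sup>2 / 4"
    and \<epsilon>: "0 < \<epsilon>" "\<epsilon> \<le> (real a * real c - (real D)\<^sup>2 / 4) / (real a + real c + real D)\<^sup>2"
  shows "tame (\<epsilon> ^ 6 / (1 + \<epsilon> ^ 6)) n d"
proof -
  define e where "e = (real a * real c - (real D)\<^sup>2 / 4) / (real a + real c + real D)\<^sup>2"
  have e0: "0 < e" using \<epsilon> by (simp add: e_def)
  have e1: "e \<le> 1"
  proof -
    have "real a * real c - (real D)\<^sup>2 / 4 \<le> (real a + real c + real D)\<^sup>2"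
      by (simp add: power2_eq_square algebra_simps)
    then show ?thesis unfolding e_def by (simp add: divide_le_eq_1)
  qed
  define w where "w = 6 * ln (1 / e)"
  have w0: "0 \<le> w" using e0 e1 by (simp add: w_def)
  have exp_w: "exp w = 1 / e ^ 6" "exp (- w) = e ^ 6"
    using e0 exp_of_nat_mult[of 6 "ln e"] by (simp_all add: w_def ln_div exp_minus field_simps)
  obtain l where l_upper: "\<And>i. i \<in> {1..n} \<Longrightarrow> - (2 * w + 1) < l i \<Longrightarrow>
        (\<Sum>j\<in>{1..n} - {i}. edge_prob (exp (l i) * exp (l j))) \<le> d i"
    and l_lower: "\<And>i. i \<in> {1..n} \<Longrightarrow> l i < 2 * w + 1 \<Longrightarrow>
        d i \<le> (\<Sum>j\<in>{1..n} - {i}. edge_prob (exp (l i) * exp (l j)))"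
    using dual_box_minimizer[of "2 * w + 1" n d] w0 by auto
  have odds: "exp (l i) * exp (l j) * e ^ 6 \<le> 1 \<and> e ^ 6 \<le> exp (l i) * exp (l j)"
    if ij: "i \<in> {1..n}" "j \<in> {1..n}" "i \<noteq> j" for i j
  proof -
    \<comment> \<open>A positive \<open>l k\<close> is off the lower face of the box, so
      \<open>l_upper\<close> applies even if \<open>l k\<close> lies on the upper face.\<close>
    have up: "(\<Sum>j\<in>{1..n} - {k}. edge_prob (exp (l k) * exp (l j))) \<le> real (a + D)"
      if k: "k \<in> {1..n}" "1 < exp (l k)" for k
    proof -
      have "- (2 * w + 1) < l k" using k w0 by simp
      then have "(\<Sum>j\<in>{1..n} - {k}. edge_prob (exp (l k) * exp (l j))) \<le> real (d k)"
        by (rule l_upper[OF k(1)])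
      also have "real (d k) \<le> real (a + D)" using deg[OF k(1)] by (simp only: of_nat_le_iff)
      finally show ?thesis .
    qed
    have low: "real a \<le> (\<Sum>j\<in>{1..n} - {k}. edge_prob (exp (l k) * exp (l j)))"
      if k: "k \<in> {1..n}" "exp (l k) < 1" for k
    proof -
      have "real a \<le> real (d k)" using deg[OF k(1)] by (simp only: of_nat_le_iff)
      also have "l k < 2 * w + 1" using k w0 by simp
      then have "real (d k) \<le> (\<Sum>j\<in>{1..n} - {k}. edge_prob (exp (l k) * exp (l j)))"
        by (rule l_lower[OF k(1)])
      finally show ?thesis .
    qed
    have "card {1..n} = a + c + D + 1" using n by simp
    from edge_odds_bounds[OF finite_atLeastAtMost this a c exp_gt_zero up low E ij, folded e_def]
    show ?thesis by blast
  qed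
  have l_sum: "\<bar>l i + l j\<bar> \<le> w" if "i \<in> {1..n}" "j \<in> {1..n}" "i \<noteq> j" for i j
  proof -
    have "exp (l i + l j) \<le> exp w" "exp (- w) \<le> exp (l i + l j)"
      using odds[OF that] e0 unfolding exp_w exp_add by (simp_all add: field_simps)
    then show ?thesis unfolding exp_le_cancel_iff by linarith
  qed
  \<comment> \<open>With two further vertices,
    \<open>2 * l i = (l i + l j) + (l i + l k) - (l j + l k)\<close>, so the modulus of
    \<open>l i\<close> is at most \<open>3 * w / 2\<close>. This is why the box of radius
    \<open>2 * w + 1\<close> is large enough.\<close>
  have interior: "\<bar>l i\<bar> < 2 * w + 1" if i: "i \<in> {1..n}" for i
  proof -
    have "2 \<le> card ({1..n} - {i})" using n a c i by simp
    then obtain J where "J \<subseteq> {1..n} - {i}" "card J = 2"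
      by (metis obtain_subset_with_card_n)
    then obtain j k where "j \<noteq> k" "j \<in> {1..n} - {i}" "k \<in> {1..n} - {i}"
      unfolding card_2_iff by blast
    then have "\<bar>l i + l j\<bar> \<le> w" "\<bar>l i + l k\<bar> \<le> w" "\<bar>l j + l k\<bar> \<le> w"
      using i by (auto intro!: l_sum)
    then show ?thesis using w0 by linarith
  qed
  have rows: "(\<Sum>j\<in>{1..n} - {i}. edge_prob (exp (l i) * exp (l j))) = d i" if "i \<in> {1..n}" for i
    using l_upper[OF that] l_lower[OF that] interior[OF that] by linarith
  have z: "(\<lambda>e\<in>pairs n. edge_prob (exp (\<Sum>k\<in>e. l k))) \<in> degree_polytope n d"
    "max_entropy_matrix n d = (\<lambda>e\<in>pairs n. edge_prob (exp (\<Sum>k\<in>e. l k)))"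
    by (rule max_entropy_matrix_eq, rule rows, assumption)+
  have \<epsilon>e: "\<epsilon> ^ 6 \<le> e ^ 6" using \<epsilon> by (intro power_mono) (auto simp: e_def)
  have "\<epsilon> \<le> 1" using \<epsilon> e1 by (simp add: e_def)
  then have \<epsilon>6: "0 < \<epsilon> ^ 6" "\<epsilon> ^ 6 \<le> 1" using \<epsilon> by (auto intro: power_le_one)
  \<comment> \<open>The bound is \<open>edge_prob (\<epsilon> ^ 6)\<close>, and its complement is
    \<open>edge_prob (1 / \<epsilon> ^ 6)\<close>, so both sides come from the odds bounds.\<close>
  have "\<epsilon> ^ 6 / (1 + \<epsilon> ^ 6) \<le> max_entropy_matrix n d {j, k}
      \<and> max_entropy_matrix n d {j, k} \<le> 1 - \<epsilon> ^ 6 / (1 + \<epsilon> ^ 6)"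
    if jk: "j \<in> {1..n}" "k \<in> {1..n}" "j \<noteq> k" for j k
  proof -
    have "{j, k} \<in> pairs n" using jk by (auto simp: pairs_def)
    then have zjk: "max_entropy_matrix n d {j, k} = edge_prob (exp (l j) * exp (l k))"
      using jk by (simp add: z(2) exp_add)
    have "edge_prob (\<epsilon> ^ 6) \<le> edge_prob (exp (l j) * exp (l k))"
      using odds[OF jk] \<epsilon>e \<epsilon>6 by (intro edge_prob_mono) auto
    moreover have "edge_prob (exp (l j) * exp (l k)) \<le> edge_prob (1 / \<epsilon> ^ 6)"
    proof (rule edge_prob_mono)
      have "exp (l j) * exp (l k) * \<epsilon> ^ 6 \<le> exp (l j) * exp (l k) * e ^ 6"
        using \<epsilon>e by (intro mult_left_mono) auto
      also have "\<dots> \<le> 1" using odds[OF jk] by simp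
      finally show "exp (l j) * exp (l k) \<le> 1 / \<epsilon> ^ 6" using \<epsilon> by (simp add: field_simps)
    qed simp
    ultimately show ?thesis
      using \<epsilon>6(1) by (simp add: zjk edge_prob_def[of "\<epsilon> ^ 6"] flip: one_minus_edge_prob)
  qed
  then show ?thesis
    using z(1) \<epsilon>6 unfolding tame_def by (auto simp: divide_le_eq add_pos_pos)
qed

text \<open>Modulo 4 the left side is 0 or 1 while the right side is 0, so a strict inequality gains
  at least 3. This sharpens \<open>D < E\<close> to \<open>D + 3/4 \<le> E\<close>, with
  \<open>E = a * c - D^2 / 4\<close>.\<close>

lemma square_gap:
  fixes a c D :: nat
  assumes "D * D + 4 * D < 4 * (a * c)"
  shows "D * D + 4 * D + 3 \<le> 4 * (a * c)"
proof (cases "even D")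
  case True
  then obtain k where k: "D = 2 * k" by blast
  have "D * D + 4 * D = 4 * (k * k + 2 * k)" by (simp add: k)
  then show ?thesis using assms by presburger
next
  case False
  then obtain k where k: "D = 2 * k + 1" by (rule oddE)
  have "D * D + 4 * D = 4 * (k * k + 3 * k + 1) + 1" by (simp add: k algebra_simps)
  then show ?thesis using assms by presburger
qed

lemma tame_of_density_range:
  fixes \<alpha> \<beta> \<epsilon> :: real and n :: nat and d :: "nat \<Rightarrow> nat"
  assumes \<alpha>\<beta>: "0 < \<alpha>" "\<alpha> < \<beta>" "\<beta> < 1"
    and \<epsilon>: "\<epsilon> = \<alpha> - (\<alpha> + \<beta>)\<^sup>2 / 4" "0 < \<epsilon>"
    and n: "(\<beta> - \<alpha>) / \<epsilon> + 1 < real n"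
    and deg: "\<And>i. i \<in> {1..n} \<Longrightarrow> \<alpha> < d i / (real n - 1) \<and> d i / (real n - 1) < \<beta>"
  shows "tame (\<epsilon> ^ 6 / (1 + \<epsilon> ^ 6)) n d"
proof -
  define m where "m = real n - 1"
  have mn: "(\<beta> - \<alpha>) / \<epsilon> < m" using n by (simp add: m_def)
  moreover have "0 < (\<beta> - \<alpha>) / \<epsilon>" using \<alpha>\<beta> \<epsilon> by simp
  ultimately have m0: "0 < m" by linarith
  have m\<epsilon>: "\<beta> - \<alpha> < m * \<epsilon>" using mn \<epsilon>(2) by (simp add: field_simps)
  have deg': "\<alpha> * m < d i" "d i < \<beta> * m" if "i \<in> {1..n}" for i
    using deg[OF that] m0 by (auto simp: m_def field_simps)
  define a where "a = Min (d ` {1..n})"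
  define M where "M = Max (d ` {1..n})"
  have n1: "1 \<le> n" using m0 by (simp add: m_def)
  have "a \<in> d ` {1..n}" "M \<in> d ` {1..n}" using n1 by (auto simp: a_def M_def intro!: Min_in Max_in)
  then have am: "\<alpha> * m < a" and Mm: "M < \<beta> * m" using deg' by auto
  have range: "a \<le> d i \<and> d i \<le> M" if "i \<in> {1..n}" for i using that by (auto simp: a_def M_def)
  have aM: "a \<le> M" using range[of 1] n1 by simp
  have "real M < m" using Mm \<alpha>\<beta> m0 by (smt (verit) mult_less_cancel_right1 mult_le_cancel_right1)
  then have Mn: "M + 1 < n" by (simp add: m_def)
  \<comment> \<open>The smallest degree of the complementary graph.\<close>
  define c where "c = n - 1 - M"
  define D where "D = M - a"
  have nacD: "n = a + c + D + 1" using Mn aM by (simp add: c_def D_def)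
  have m_eq: "m = real a + real c + real D" by (simp add: m_def nacD)
  have Mr: "real M = real a + real D" using aM by (simp add: D_def)
  have "0 < \<alpha> * m" using \<alpha>\<beta> m0 by simp
  then have a1: "1 \<le> a" using am by (metis less_one not_less of_nat_0 less_asym)
  have c1: "1 \<le> c" using Mn by (simp add: c_def)
  have cm: "(1 - \<beta>) * m < c" using Mm m_eq Mr by (simp add: algebra_simps)
  define E where "E = real a * real c - (real D)\<^sup>2 / 4"
  \<comment> \<open>The left side is the value of \<open>E\<close> at
    \<open>a = \<alpha> * m\<close>, \<open>c = (1 - \<beta>) * m\<close>,
    \<open>D = (\<beta> - \<alpha>) * m\<close>. For fixed \<open>a + c + D = m\<close>,
    \<open>E\<close> increases with \<open>a\<close> and \<open>c\<close>.\<close>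
  have "\<epsilon> * m\<^sup>2 \<le> E"
  proof -
    define X Y where "X = \<alpha> * m" and "Y = (1 - \<beta>) * m"
    have XY: "0 \<le> X" "0 \<le> Y" "X \<le> a" "Y \<le> c" "0 \<le> real D"
      using \<alpha>\<beta> m0 am cm by (auto simp: X_def Y_def)
    have "\<epsilon> * m\<^sup>2 = X * Y - (m - X - Y)\<^sup>2 / 4"
      by (simp add: \<epsilon>(1) X_def Y_def power2_eq_square field_simps)
    moreover have "E - (X * Y - (m - X - Y)\<^sup>2 / 4)
      = (a - X) * Y + (c - Y) * a + ((a - X) + (c - Y)) * (2 * real D + (a - X) + (c - Y)) / 4"
      by (simp add: E_def m_eq power2_eq_square field_simps)
    moreover have "0 \<le> \<dots>"
      using XY by (intro add_nonneg_nonneg mult_nonneg_nonneg divide_nonneg_nonneg) auto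
    ultimately show ?thesis by simp
  qed
  \<comment> \<open>Here \<open>n\<close> has to be large: the linear bound on \<open>D\<close>
    falls below \<open>\<epsilon> * m^2\<close> once
    \<open>m > (\<beta> - \<alpha>) / \<epsilon>\<close>.\<close>
  have "real D < (\<beta> - \<alpha>) * m" using am Mm Mr by (simp add: algebra_simps)
  also have "\<dots> < (m * \<epsilon>) * m" using m\<epsilon> m0 by (intro mult_strict_right_mono)
  also have "\<dots> = \<epsilon> * m\<^sup>2" by (simp add: power2_eq_square)
  also note \<open>\<epsilon> * m\<^sup>2 \<le> E\<close>
  finally have "real D < E" .
  then have "real (D * D + 4 * D) < real (4 * (a * c))"
    by (simp add: E_def power2_eq_square field_simps)
  then have "D * D + 4 * D < 4 * (a * c)" by (simp only: of_nat_less_iff)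
  then have "real (D * D + 4 * D + 3) \<le> real (4 * (a * c))"
    by (intro of_nat_mono square_gap)
  then have DE: "real D + 3 / 4 \<le> real a * real c - (real D)\<^sup>2 / 4"
    by (simp add: power2_eq_square field_simps)
  have "\<epsilon> \<le> E / m\<^sup>2" using \<open>\<epsilon> * m\<^sup>2 \<le> E\<close> m0 by (simp add: field_simps)
  then have \<epsilon>_le: "\<epsilon> \<le> (real a * real c - (real D)\<^sup>2 / 4) / (real a + real c + real D)\<^sup>2"
    by (simp only: E_def m_eq)
  have "a \<le> d i \<and> d i \<le> a + D" if "i \<in> {1..n}" for i
    using range[OF that] aM by (simp add: D_def)
  then show ?thesis by (rule tame_of_degree_range[OF nacD a1 c1 _ DE \<epsilon>(2) \<epsilon>_le])
qed

theorem theorem2p1: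
  fixes \<alpha> \<beta> :: real
  assumes "0 < \<alpha>" and "\<alpha> < \<beta>" and "\<beta> < 1"
    and "\<beta> < 2 * sqrt \<alpha> - \<alpha>"
  shows "(\<exists>\<delta>::real. \<exists>n\<^sub>0::nat. 0 < \<delta> \<and> 0 < n\<^sub>0 \<and>
           (\<forall>n::nat. \<forall>d::nat \<Rightarrow> nat. n > n\<^sub>0 \<longrightarrow>
              (\<forall>i\<in>{1..n}. 0 < d i \<and> \<alpha> < real (d i) / (real n - 1) \<and>
                                      real (d i) / (real n - 1) < \<beta>) \<longrightarrow>
              tame \<delta> n d)) \<and>
         (let n\<^sub>0 = max (\<beta> / (\<alpha> * (1 - \<beta>))) (4 * (\<beta> - \<alpha>) / (4 * \<alpha> - (\<alpha> + \<beta>)\<^sup>2)) + 1;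
              \<epsilon> = min \<alpha> (\<alpha> - (\<alpha> + \<beta>)\<^sup>2 / 4);
              \<delta> = \<epsilon> ^ 6 / (1 + \<epsilon> ^ 6)
          in 0 < \<delta> \<and> 0 < n\<^sub>0 \<and>
           (\<forall>n::nat. \<forall>d::nat \<Rightarrow> nat. real n > n\<^sub>0 \<longrightarrow>
              (\<forall>i\<in>{1..n}. 0 < d i \<and> \<alpha> < real (d i) / (real n - 1) \<and>
                                      real (d i) / (real n - 1) < \<beta>) \<longrightarrow>
              tame \<delta> n d))"
proof -
  define \<epsilon> where "\<epsilon> = \<alpha> - (\<alpha> + \<beta>)\<^sup>2 / 4"
  define N where "N = max (\<beta> / (\<alpha> * (1 - \<beta>))) (4 * (\<beta> - \<alpha>) / (4 * \<alpha> - (\<alpha> + \<beta>)\<^sup>2)) + 1"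
  have \<epsilon>0: "0 < \<epsilon>"
  proof -
    have "(\<alpha> + \<beta>)\<^sup>2 < (2 * sqrt \<alpha>)\<^sup>2" using assms by (intro power_strict_mono) auto
    then show ?thesis using assms(1) by (simp add: \<epsilon>_def power_mult_distrib)
  qed
  have \<epsilon>_min: "min \<alpha> (\<alpha> - (\<alpha> + \<beta>)\<^sup>2 / 4) = \<epsilon>" by (simp add: \<epsilon>_def)
  have "4 * (\<beta> - \<alpha>) / (4 * \<alpha> - (\<alpha> + \<beta>)\<^sup>2) = (4 * (\<beta> - \<alpha>)) / (4 * \<epsilon>)"
    by (simp add: \<epsilon>_def algebra_simps)
  also have "\<dots> = (\<beta> - \<alpha>) / \<epsilon>" by (rule mult_divide_mult_cancel_left) simp
  finally have N: "(\<beta> - \<alpha>) / \<epsilon> + 1 \<le> N" by (simp add: N_def)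
  have \<delta>0: "0 < \<epsilon> ^ 6 / (1 + \<epsilon> ^ 6)" using \<epsilon>0 by (simp add: add_pos_pos)
  have "0 < (\<beta> - \<alpha>) / \<epsilon>" using assms \<epsilon>0 by simp
  then have N0: "0 < N" using N by linarith
  have tame: "tame (\<epsilon> ^ 6 / (1 + \<epsilon> ^ 6)) n d"
    if "N < real n" "\<forall>i\<in>{1..n}. 0 < d i \<and> \<alpha> < real (d i) / (real n - 1) \<and> real (d i) / (real n - 1) < \<beta>"
    for n d
    using that N by (intro tame_of_density_range[OF assms(1-3) \<epsilon>_def \<epsilon>0]) auto
  have "0 < nat \<lceil>N\<rceil>" using N0 by simp
  moreover have "N < real n" if "nat \<lceil>N\<rceil> < n" for n using that N0 by linarith
  ultimately have "\<exists>\<delta>::real. \<exists>n\<^sub>0::nat. 0 < \<delta> \<and> 0 < n\<^sub>0 \<and>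
           (\<forall>n::nat. \<forall>d::nat \<Rightarrow> nat. n > n\<^sub>0 \<longrightarrow>
              (\<forall>i\<in>{1..n}. 0 < d i \<and> \<alpha> < real (d i) / (real n - 1) \<and>
                                      real (d i) / (real n - 1) < \<beta>) \<longrightarrow>
              tame \<delta> n d)"
    using \<delta>0 tame by blast
  then show ?thesis using \<delta>0 N0 tame unfolding Let_def \<epsilon>_min N_def by blast
qed

end
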